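(* Let $\Theta$ be an orthosymmetric subset of the space of real sequences $\theta=(\theta_1,\theta_2,\dots)$, and consider the Gaussian sequence model $Y_i=\theta_i+n^{-1/2}z_i$, $i=1,2,\dots$, with $z_i$ i.i.d. $N(0,1)$. Let $\hat Q=\sum_i a_iY_i^2+c$ be any diagonal quadratic estimator of $Q(\theta)=\sum_{i}\theta_i^2$. Then $$\sup_{\theta\in\Theta}E_\theta(\hat Q-Q(\theta))^2=\sup_{\theta\in \mathrm{Q.Hull}(\Theta)}E_\theta(\hat Q-Q(\theta))^2 .$$ Consequently $$R_Q^*(n;\Theta)=R_Q^*(n;\mathrm{Q.Hull}(\Theta))=R_{DQ}^*(n;\mathrm{Q.Hull}(\Theta)).$$
   Context: A set $\Theta$ of sequences is orthosymmetric if $\theta\in\Theta$ implies $(\pm\theta_1,\pm\theta_2,\dots)\in\Theta$ for every choice of signs. The quadratic convex hull of an orthosymmetric $\Theta$ is $\mathrm{Q.Hull}(\Theta)=\{(\theta_i)_{i\ge1}:(\theta_i^2)_{i\ge1}\in\mathrm{Hull}(\Theta_+^2)\}$, where $\Theta_+^2=\{(\theta_i^2)_{i\ge1}:\theta\in\Theta,\ \theta_i\ge0\ \forall i\}$ and $\mathrm{Hull}$ denotes the convex hull. A quadratic estimator is one of the form $\sum_{i,j}a_{i,j}Y_iY_j+c$; the class of all such is $\mathcal Q$; a diagonal quadratic estimator is one of the form $\sum_i a_iY_i^2+c$, the class of these being $\mathcal Q_D$. For a parameter set $\Theta$, $R_Q^*(n,\Theta)=\inf_{\hat Q\in\mathcal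 Q}\sup_{\theta\in\Theta}E_\theta(\hat Q-Q(\theta))^2$ and $R_{DQ}^*(n,\Theta)=\inf_{\hat Q\in\mathcal Q_D}\sup_{\theta\in\Theta}E_\theta(\hat Q-Q(\theta))^2$. *)

theory Defs
  imports "HOL-Probability.Probability"
begin

type_synonym seq = "nat \<Rightarrow> real"

definition orthosymmetric :: "seq set \<Rightarrow> bool" where
  "orthosymmetric \<Theta> \<longleftrightarrow>
     (\<forall>\<theta>\<in>\<Theta>. \<forall>\<epsilon>::nat \<Rightarrow> real. (\<forall>i. \<epsilon> i = 1 \<or> \<epsilon> i = -1) \<longrightarrow> (\<lambda>i. \<epsilon> i * \<theta> i) \<in> \<Theta>)"

definition seq_hull :: "seq set \<Rightarrow> seq set" where
  "seq_hull S = {x. \<exists>(k::nat) (w::nat \<Rightarrow> real) (p::nat \<Rightarrow> seq).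
       (\<forall>j<k. 0 \<le> w j \<and> p j \<in> S) \<and> (\<Sum>j<k. w j) = 1 \<and> x = (\<lambda>i. \<Sum>j<k. w j * p j i)}"

definition sq_pos :: "seq set \<Rightarrow> seq set" where
  "sq_pos \<Theta> = {(\<lambda>i. (\<theta> i)\<^sup>2) | \<theta>. \<theta> \<in> \<Theta> \<and> (\<forall>i. 0 \<le> \<theta> i)}"

definition QHull :: "seq set \<Rightarrow> seq set" where
  "QHull \<Theta> = {\<theta>. (\<lambda>i. (\<theta> i)\<^sup>2) \<in> seq_hull (sq_pos \<Theta>)}"

definition Qf :: "seq \<Rightarrow> real" where
  "Qf \<theta> = (\<Sum>i. (\<theta> i)\<^sup>2)"

definition gauss_noise :: "seq measure" where
  "gauss_noise = PiM UNIV (\<lambda>_::nat. density lborel std_normal_density)"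

definition Yobs :: "nat \<Rightarrow> seq \<Rightarrow> seq \<Rightarrow> seq" where
  "Yobs n \<theta> z = (\<lambda>i. \<theta> i + z i / sqrt (real n))"

text \<open>Quadratic form sum_{i,j} a_ij Y_i Y_j, understood as the limit of square partial sums.\<close>
definition qpart :: "(nat \<Rightarrow> nat \<Rightarrow> real) \<Rightarrow> seq \<Rightarrow> nat \<Rightarrow> real" where
  "qpart A Y N = (\<Sum>i<N. \<Sum>j<N. A i j * Y i * Y j)"

definition qest :: "(nat \<Rightarrow> nat \<Rightarrow> real) \<Rightarrow> real \<Rightarrow> seq \<Rightarrow> real" where
  "qest A c Y = lim (qpart A Y) + c"

definition risk :: "nat \<Rightarrow> (nat \<Rightarrow> nat \<Rightarrow> real) \<Rightarrow> real \<Rightarrow> seq \<Rightarrow> ennreal" where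
  "risk n A c \<theta> =
     (if summable (\<lambda>i. (\<theta> i)\<^sup>2) \<and> (AE z in gauss_noise. convergent (qpart A (Yobs n \<theta> z)))
      then (\<integral>\<^sup>+ z. ennreal ((qest A c (Yobs n \<theta> z) - Qf \<theta>)\<^sup>2) \<partial>gauss_noise)
      else \<infinity>)"

definition worst_risk :: "nat \<Rightarrow> (nat \<Rightarrow> nat \<Rightarrow> real) \<Rightarrow> real \<Rightarrow> seq set \<Rightarrow> ennreal" where
  "worst_risk n A c \<Theta> = (SUP \<theta>\<in>\<Theta>. risk n A c \<theta>)"

definition diagonal :: "(nat \<Rightarrow> nat \<Rightarrow> real) \<Rightarrow> bool" where
  "diagonal A \<longleftrightarrow> (\<forall>i j. i \<noteq> j \<longrightarrow> A i j = 0)"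

definition R_Q :: "nat \<Rightarrow> seq set \<Rightarrow> ennreal" where
  "R_Q n \<Theta> = (INF Ac\<in>(UNIV :: ((nat \<Rightarrow> nat \<Rightarrow> real) \<times> real) set). worst_risk n (fst Ac) (snd Ac) \<Theta>)"

definition R_DQ :: "nat \<Rightarrow> seq set \<Rightarrow> ennreal" where
  "R_DQ n \<Theta> = (INF Ac\<in>{Ac :: (nat \<Rightarrow> nat \<Rightarrow> real) \<times> real. diagonal (fst Ac)}. worst_risk n (fst Ac) (snd Ac) \<Theta>)"

end

theory Submission
  imports Defs
begin

text \<open>
  For a diagonal estimator with finite risk, the coefficients are square summable with convergent sum, and the
  risk is a variance that is affine in the squared signal plus the square of a bias that is affine in it. It is
  therefore convex in the squared signal, so passing to the quadratic convex hull does not increase the supremum.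

  For a general quadratic form, Jensen's inequality over random signs of the signal replaces the form by its
  diagonal part without increasing the worst risk. To justify this for forms that are only conditionally
  convergent, the signs of finitely many observations are averaged first, which decouples those coordinates.
  Finiteness of the risk bounds the off-diagonal coefficients (the Gaussian chaos coefficients of the limit) by
  Bessel's inequality, so that the remaining off-diagonal tail vanishes in mean square; almost sure convergence
  of the diagonal part follows from Kolmogorov's maximal inequality.
\<close>

section \<open>Gaussian noise\<close>

text \<open>A form enters only through the almost sure limit of its square partial sums. No
  summability of the coefficients is assumed, and expectations of partial sums need not converge to
  that of the limit, so every analytic fact has to be extracted from finiteness of the risk.
  Averaging over all signs at once would exchange this limit with an infinite average; the average
  of two convergent sequences is harmless, hence one coordinate is averaged at a time. What remains
  after \<open>K\<close> averages still couples the coordinates from \<open>K\<close> on. That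
  remainder is small in mean square but may be correlated with the diagonal part as soon as the
  signal is nonzero, so the final comparison first loses a factor 1 - eta. Square summability of the
  diagonal coefficients does not imply convergence of their sum, which the mean of the diagonal
  estimator requires; this sum is recovered separately from the convergence of the form.\<close>

definition signs :: "seq \<Rightarrow> bool" where
  "signs e \<longleftrightarrow> (\<forall>i. e i = 1 \<or> e i = -1)"

text \<open>Independence is used in this form: functions of disjoint sets of coordinates. Stated
  pointwise, it can be checked by unfolding, even for functions defined through
  \<open>lim\<close>.\<close>

definition depends_on :: "nat set \<Rightarrow> (seq \<Rightarrow> 'a) \<Rightarrow> bool" where
  "depends_on I f \<longleftrightarrow> (\<forall>z z'. (\<forall>i\<in>I. z i = z' i) \<longrightarrow> f z = f z')"

lemma signs_square: "signs e \<Longrightarrow> e i * e i = 1"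
  by (auto simp: signs_def dest: spec[of _ i])

lemma prob_space_std_normal: "prob_space std_normal_distribution"
  by (rule prob_space_normal_density) simp

interpretation gauss_prod: product_prob_space "\<lambda>_::nat. std_normal_distribution" UNIV
  by (intro product_prob_spaceI prob_space_std_normal)

interpretation gauss: prob_space gauss_noise
  unfolding gauss_noise_def by (rule gauss_prod.P.prob_space_axioms)

lemma space_gauss_noise [simp]: "space gauss_noise = UNIV"
  by (simp add: gauss_noise_def space_PiM)

lemma prob_gauss_UNIV [simp]: "gauss.prob UNIV = 1"
  using gauss.prob_space by simp

lemma sets_gauss_noise [measurable_cong]: "sets gauss_noise = sets (PiM UNIV (\<lambda>_. borel))"
  unfolding gauss_noise_def by (intro sets_PiM_cong) auto

lemma gauss_coordinate [measurable]: "(\<lambda>z. z i) \<in> borel_measurable gauss_noise"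
  by measurable

lemma distr_gauss_coordinate: "distr gauss_noise borel (\<lambda>z. z i) = std_normal_distribution"
proof -
  have "distr gauss_noise borel (\<lambda>z. z i) = distr gauss_noise std_normal_distribution (\<lambda>z. z i)"
    by (rule distr_cong) auto
  then show ?thesis
    unfolding gauss_noise_def using gauss_prod.PiM_component[of i] by simp
qed

lemma distr_std_normal_sign:
  assumes "e = 1 \<or> e = (-1::real)"
  shows "distr std_normal_distribution borel (\<lambda>x. e * x) = std_normal_distribution"
proof -
  have d: "distributed std_normal_distribution lborel (\<lambda>x. x) std_normal_density"
    unfolding distributed_def by (auto intro!: measure_eqI simp: emeasure_distr)
  have "distributed std_normal_distribution lborel (\<lambda>x. 0 + e * x) (normal_density (0 + e * 0) (\<bar>e\<bar> * 1))"
    by (rule prob_space.normal_density_affine[OF prob_space_std_normal d]) (use assms in auto)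
  then have "distributed std_normal_distribution lborel (\<lambda>x. e * x) std_normal_density"
    using assms by auto
  then have "distr std_normal_distribution lborel (\<lambda>x. e * x) = std_normal_distribution"
    by (simp add: distributed_def)
  moreover have "distr std_normal_distribution lborel (\<lambda>x. e * x) = distr std_normal_distribution borel (\<lambda>x. e * x)"
    by (rule distr_cong) auto
  ultimately show ?thesis by simp
qed

lemma measurable_coordinatewise [measurable]:
  "(\<lambda>z i. e i * z i) \<in> gauss_noise \<rightarrow>\<^sub>M gauss_noise"
  unfolding measurable_cong_sets[OF refl sets_gauss_noise] by (rule measurable_PiM_single') auto

text \<open>A product measure is determined by its values on cylinders over finitely many
  coordinates, and there the claim reduces to the symmetry of the one-dimensional normal
  law.\<close>

lemma distr_gauss_signs:
  assumes e: "signs e"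
  shows "distr gauss_noise gauss_noise (\<lambda>z i. e i * z i) = gauss_noise"
proof -
  let ?N = "\<lambda>_::nat. std_normal_distribution"
  have "distr gauss_noise gauss_noise (\<lambda>z i. e i * z i) = PiM UNIV ?N"
  proof (rule gauss_prod.PiM_eq)
    show "sets (distr gauss_noise gauss_noise (\<lambda>z i. e i * z i)) = sets (PiM UNIV ?N)"
      by (simp add: gauss_noise_def)
    fix J :: "nat set" and F assume J: "finite J" and F: "\<And>j. j \<in> J \<Longrightarrow> F j \<in> sets (?N j)"
    have m: "prod_emb UNIV ?N J (Pi\<^sub>E J F) \<in> sets gauss_noise"
      unfolding gauss_noise_def using J F by (intro sets_PiM_I) auto
    have F': "(\<lambda>x. e j * x) -` F j \<in> sets (?N j)" if "j \<in> J" for j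
      using measurable_sets[of "\<lambda>x::real. e j * x" borel borel "F j"] F[OF that] by simp
    have "emeasure (distr gauss_noise gauss_noise (\<lambda>z i. e i * z i)) (prod_emb UNIV ?N J (Pi\<^sub>E J F))
        = emeasure gauss_noise ((\<lambda>z i. e i * z i) -` prod_emb UNIV ?N J (Pi\<^sub>E J F))"
      using m by (subst emeasure_distr) auto
    also have "(\<lambda>z i. e i * z i) -` prod_emb UNIV ?N J (Pi\<^sub>E J F)
        = prod_emb UNIV ?N J (Pi\<^sub>E J (\<lambda>j. (\<lambda>x. e j * x) -` F j))"
      by (auto simp: prod_emb_def space_PiM PiE_iff)
    also have "emeasure gauss_noise \<dots> = (\<Prod>j\<in>J. emeasure (?N j) ((\<lambda>x. e j * x) -` F j))"
      unfolding gauss_noise_def by (rule gauss_prod.emeasure_PiM_emb) (use J F' in auto)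
    also have "\<dots> = (\<Prod>j\<in>J. emeasure (?N j) (F j))"
    proof (rule prod.cong[OF refl])
      fix j assume "j \<in> J"
      have "e j = 1 \<or> e j = -1" using e by (auto simp: signs_def)
      from distr_std_normal_sign[OF this]
      have "emeasure (?N j) (F j) = emeasure (distr (?N j) borel (\<lambda>x. e j * x)) (F j)" by simp
      also have "\<dots> = emeasure (?N j) ((\<lambda>x. e j * x) -` F j)"
        using F[OF \<open>j \<in> J\<close>] by (subst emeasure_distr) auto
      finally show "emeasure (?N j) ((\<lambda>x. e j * x) -` F j) = emeasure (?N j) (F j)" ..
    qed
    finally show "emeasure (distr gauss_noise gauss_noise (\<lambda>z i. e i * z i)) (prod_emb UNIV ?N J (Pi\<^sub>E J F))
       = (\<Prod>j\<in>J. emeasure (?N j) (F j))" .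
  qed
  then show ?thesis by (simp add: gauss_noise_def)
qed

lemma AE_gauss_signs:
  assumes "signs e" "AE z in gauss_noise. P z"
  shows "AE z in gauss_noise. P (\<lambda>i. e i * z i)"
  using AE_distrD[OF measurable_coordinatewise[of e], of P] assms(2)
  unfolding distr_gauss_signs[OF assms(1)] by blast

lemma integral_gauss_signs:
  fixes f :: "seq \<Rightarrow> real"
  assumes "signs e" "f \<in> borel_measurable gauss_noise"
  shows "(\<integral>z. f (\<lambda>i. e i * z i) \<partial>gauss_noise) = (\<integral>z. f z \<partial>gauss_noise)"
  using integral_distr[OF measurable_coordinatewise, of f e] assms by (simp add: distr_gauss_signs)

lemma integrable_gauss_signs:
  fixes f :: "seq \<Rightarrow> real"
  assumes "signs e" "integrable gauss_noise f"
  shows "integrable gauss_noise (\<lambda>z. f (\<lambda>i. e i * z i))"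
  using integrable_distr[OF measurable_coordinatewise, of e f] assms by (simp add: distr_gauss_signs)

lemma nn_integral_gauss_signs:
  assumes "signs e" "f \<in> borel_measurable gauss_noise"
  shows "(\<integral>\<^sup>+z. f (\<lambda>i. e i * z i) \<partial>gauss_noise) = (\<integral>\<^sup>+z. f z \<partial>gauss_noise)"
  using nn_integral_distr[OF measurable_coordinatewise, of f e] assms by (simp add: distr_gauss_signs)

lemma indep_vars_gauss: "gauss.indep_vars (\<lambda>_. borel) (\<lambda>i z. z i) UNIV"
proof -
  have "distr gauss_noise (PiM UNIV (\<lambda>_. borel)) (\<lambda>x. \<lambda>i\<in>UNIV. x i) = gauss_noise"
    using distr_id2[of "PiM UNIV (\<lambda>_. borel)" gauss_noise] sets_gauss_noise
    by (simp add: restrict_UNIV id_def)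
  moreover have "PiM UNIV (\<lambda>i. distr gauss_noise borel (\<lambda>z. z i)) = gauss_noise"
    unfolding distr_gauss_coordinate by (simp add: gauss_noise_def)
  ultimately show ?thesis
    by (subst gauss.indep_vars_iff_distr_eq_PiM) auto
qed

lemma integral_mult_depends_on:
  fixes f g :: "seq \<Rightarrow> real"
  assumes f: "depends_on I f" "integrable gauss_noise f"
    and g: "depends_on J g" "integrable gauss_noise g" and IJ: "I \<inter> J = {}"
  shows "(\<integral>z. f z * g z \<partial>gauss_noise) = (\<integral>z. f z \<partial>gauss_noise) * (\<integral>z. g z \<partial>gauss_noise)"
proof -
  \<comment> \<open>Independence of restrictions applies to measurable functions of the restricted
    sequence. Padding by zeros presents \<open>f\<close> as such a function, and
    \<open>depends_on\<close> makes the padding invisible.\<close>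
  define ext :: "nat set \<Rightarrow> seq \<Rightarrow> seq" where "ext I x = (\<lambda>i. if i \<in> I then x i else 0)" for I x
  have ext: "ext I \<in> PiM I (\<lambda>_. borel) \<rightarrow>\<^sub>M gauss_noise" for I
    unfolding measurable_cong_sets[OF refl sets_gauss_noise] ext_def
  proof (rule measurable_PiM_single')
    fix i show "(\<lambda>x. if i \<in> I then x i else 0) \<in> borel_measurable (Pi\<^sub>M I (\<lambda>_. borel::real measure))"
      by (cases "i \<in> I") auto
  qed auto
  have [measurable]: "f \<in> borel_measurable gauss_noise" "g \<in> borel_measurable gauss_noise"
    using f g by auto
  have "gauss.indep_var borel ((\<lambda>x. f (ext I x)) \<circ> (\<lambda>z. restrict (\<lambda>i. z i) I)) borel ((\<lambda>x. g (ext J x)) \<circ> (\<lambda>z. restrict (\<lambda>i. z i) J))"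
    by (rule gauss.indep_var_compose[OF gauss.indep_var_restrict[OF indep_vars_gauss IJ]])
      (auto intro!: measurable_compose[OF ext])
  moreover have "(\<lambda>x. f (ext I x)) \<circ> (\<lambda>z. restrict (\<lambda>i. z i) I) = f"
    using f(1) by (auto simp: fun_eq_iff depends_on_def ext_def)
  moreover have "(\<lambda>x. g (ext J x)) \<circ> (\<lambda>z. restrict (\<lambda>i. z i) J) = g"
    using g(1) by (auto simp: fun_eq_iff depends_on_def ext_def)
  ultimately have i: "gauss.indep_var borel f borel g" by simp
  show ?thesis
    using gauss.indep_var_lebesgue_integral[OF i] f(2) g(2) by auto
qed

lemma integral_gauss_coordinate:
  fixes h :: "real \<Rightarrow> real"
  assumes "h \<in> borel_measurable borel"
  shows "(\<integral>z. h (z i) \<partial>gauss_noise) = (\<integral>x. h x \<partial>std_normal_distribution)"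
  using integral_distr[OF gauss_coordinate assms, of i] by (simp add: distr_gauss_coordinate)

lemma integrable_gauss_power [simp, intro]: "integrable gauss_noise (\<lambda>z. z i ^ k)"
  using integrable_distr[OF gauss_coordinate, of i "\<lambda>x. x ^ k"] integrable_std_normal_distribution_moment[of k]
  by (simp add: distr_gauss_coordinate)

lemma integrable_gauss_coordinate [simp, intro]: "integrable gauss_noise (\<lambda>z. z i)"
  using integrable_gauss_power[of i 1] by simp

lemma gauss_moments:
  "(\<integral>z. z i \<partial>gauss_noise) = 0" "(\<integral>z. (z i)\<^sup>2 \<partial>gauss_noise) = 1"
  "(\<integral>z. z i ^ 3 \<partial>gauss_noise) = 0" "(\<integral>z. z i ^ 4 \<partial>gauss_noise) = 3"
  using integral_gauss_coordinate[of "\<lambda>x. x ^ 1" i] integral_std_normal_distribution_moment_odd[of 1]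
    integral_gauss_coordinate[of "\<lambda>x. x ^ 2" i] std_normal_distribution_even_moments(1)[of 1]
    integral_gauss_coordinate[of "\<lambda>x. x ^ 3" i] integral_std_normal_distribution_moment_odd[of 3]
    integral_gauss_coordinate[of "\<lambda>x. x ^ 4" i] std_normal_distribution_even_moments(1)[of 2]
  by (simp_all add: fact_numeral)

section \<open>Square integrable functionals of the noise\<close>

definition L2 :: "(seq \<Rightarrow> real) set" where
  "L2 = {f \<in> borel_measurable gauss_noise. integrable gauss_noise (\<lambda>z. (f z)\<^sup>2)}"

lemma L2_measurable [measurable_dest]: "f \<in> L2 \<Longrightarrow> f \<in> borel_measurable gauss_noise"
  and L2_integrable_square: "f \<in> L2 \<Longrightarrow> integrable gauss_noise (\<lambda>z. (f z)\<^sup>2)"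
  by (auto simp: L2_def)

lemma L2_bound:
  assumes "g \<in> L2" "f \<in> borel_measurable gauss_noise" "AE z in gauss_noise. \<bar>f z\<bar> \<le> \<bar>g z\<bar>"
  shows "f \<in> L2"
proof -
  have "integrable gauss_noise (\<lambda>z. (f z)\<^sup>2)"
    by (rule Bochner_Integration.integrable_bound[OF L2_integrable_square[OF assms(1)]])
      (use assms in \<open>auto simp: abs_le_square_iff\<close>)
  then show ?thesis using assms by (simp add: L2_def)
qed

lemma L2_mult_integrable:
  assumes "f \<in> L2" "g \<in> L2"
  shows "integrable gauss_noise (\<lambda>z. f z * g z)"
proof (rule Bochner_Integration.integrable_bound)
  show "integrable gauss_noise (\<lambda>z. (f z)\<^sup>2 + (g z)\<^sup>2)"
    using assms by (auto simp: L2_def)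
  have "\<bar>x * y\<bar> \<le> x\<^sup>2 + y\<^sup>2" for x y :: real
    using sum_squares_bound[of "\<bar>x\<bar>" "\<bar>y\<bar>"] mult_nonneg_nonneg[of "\<bar>x\<bar>" "\<bar>y\<bar>"]
    unfolding abs_mult by (simp del: mult_nonneg_nonneg)
  then show "AE z in gauss_noise. norm (f z * g z) \<le> norm ((f z)\<^sup>2 + (g z)\<^sup>2)"
    by (intro AE_I2) (simp add: order_trans[OF _ abs_ge_self])
qed (use assms in \<open>auto simp: L2_def\<close>)

lemma L2_const [simp, intro]: "(\<lambda>_. c) \<in> L2"
  by (simp add: L2_def)

lemma L2_integrable: "f \<in> L2 \<Longrightarrow> integrable gauss_noise f"
  using L2_mult_integrable[of f "\<lambda>_. 1"] by simp

lemma L2_scale: "f \<in> L2 \<Longrightarrow> (\<lambda>z. c * f z) \<in> L2"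
  by (auto simp: L2_def power_mult_distrib)

lemma L2_add: "f \<in> L2 \<Longrightarrow> g \<in> L2 \<Longrightarrow> (\<lambda>z. f z + g z) \<in> L2"
  using L2_mult_integrable[of f g] by (auto simp: L2_def power2_sum mult.assoc)

lemma L2_diff: "f \<in> L2 \<Longrightarrow> g \<in> L2 \<Longrightarrow> (\<lambda>z. f z - g z) \<in> L2"
  using L2_add[of f "\<lambda>z. -1 * g z"] L2_scale[of g "-1"] by simp

lemma L2_sum: "(\<And>i. i \<in> I \<Longrightarrow> f i \<in> L2) \<Longrightarrow> (\<lambda>z. \<Sum>i\<in>I. f i z) \<in> L2"
  by (induction I rule: infinite_finite_induct) (auto intro: L2_add)

lemma L2_signs: "signs e \<Longrightarrow> f \<in> L2 \<Longrightarrow> (\<lambda>z. f (\<lambda>i. e i * z i)) \<in> L2"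
  using integrable_gauss_signs[of e "\<lambda>z. (f z)\<^sup>2"] by (auto simp: L2_def intro: measurable_compose[OF measurable_coordinatewise])

lemma L2_cong_AE:
  assumes "f \<in> L2" "g \<in> borel_measurable gauss_noise" "AE z in gauss_noise. f z = g z"
  shows "g \<in> L2"
  by (rule L2_bound[OF assms(1,2)]) (use assms(3) in auto)

lemma L2_coordinate [simp, intro]: "(\<lambda>z. z i) \<in> L2"
  by (simp add: L2_def)

lemma L2_coordinate_mult [simp, intro]: "(\<lambda>z. z i * z j) \<in> L2"
proof -
  have "integrable gauss_noise (\<lambda>z. (z i * z j)\<^sup>2)"
  proof (rule Bochner_Integration.integrable_bound)
    show "integrable gauss_noise (\<lambda>z. z i ^ 4 + z j ^ 4)" by simp
    have "(x * y)\<^sup>2 \<le> x ^ 4 + y ^ 4" for x y :: real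
      using sum_squares_bound[of "x\<^sup>2" "y\<^sup>2"] mult_nonneg_nonneg[of "x\<^sup>2" "y\<^sup>2"]
      by (simp add: power_mult_distrib del: mult_nonneg_nonneg zero_le_power2)
    then show "AE z in gauss_noise. norm ((z i * z j)\<^sup>2) \<le> norm (z i ^ 4 + z j ^ 4)"
      by (intro AE_I2) (simp add: order_trans[OF _ abs_ge_self])
  qed auto
  then show ?thesis by (simp add: L2_def)
qed

lemma nn_integral_L2:
  "f \<in> L2 \<Longrightarrow> (\<integral>\<^sup>+z. ennreal ((f z)\<^sup>2) \<partial>gauss_noise) = ennreal (\<integral>z. (f z)\<^sup>2 \<partial>gauss_noise)"
  by (intro nn_integral_eq_integral) (auto simp: L2_def)

text \<open>The passage from the extended real risk to ordinary integrals: a finite bound on the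
  former yields both integrability and the same real bound.\<close>

lemma
  assumes "f \<in> borel_measurable gauss_noise" "(\<integral>\<^sup>+z. ennreal ((f z)\<^sup>2) \<partial>gauss_noise) \<le> ennreal c" "0 \<le> c"
  shows L2_nn_integralI: "f \<in> L2" and integral_square_le: "(\<integral>z. (f z)\<^sup>2 \<partial>gauss_noise) \<le> c"
proof -
  have "integrable gauss_noise (\<lambda>z. (f z)\<^sup>2)"
    using assms by (intro integrableI_nonneg) (auto simp: le_less_trans)
  then show f: "f \<in> L2" using assms by (simp add: L2_def)
  show "(\<integral>z. (f z)\<^sup>2 \<partial>gauss_noise) \<le> c"
    using assms(2,3) nn_integral_L2[OF f] by simp
qed

lemma integral_square_add:
  assumes "f \<in> L2" "g \<in> L2"
  shows "(\<integral>z. (f z + g z)\<^sup>2 \<partial>gauss_noise)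
    = (\<integral>z. (f z)\<^sup>2 \<partial>gauss_noise) + 2 * (\<integral>z. f z * g z \<partial>gauss_noise) + (\<integral>z. (g z)\<^sup>2 \<partial>gauss_noise)"
proof -
  have "(\<integral>z. (f z + g z)\<^sup>2 \<partial>gauss_noise) = (\<integral>z. (f z)\<^sup>2 + 2 * (f z * g z) + (g z)\<^sup>2 \<partial>gauss_noise)"
    by (simp add: power2_sum algebra_simps)
  then show ?thesis
    using L2_mult_integrable[OF assms] assms by (simp add: L2_integrable_square)
qed

lemma integral_square_sum_orthogonal:
  assumes "finite I" "\<And>p. p \<in> I \<Longrightarrow> f p \<in> L2"
    and "\<And>p q. p \<in> I \<Longrightarrow> q \<in> I \<Longrightarrow> p \<noteq> q \<Longrightarrow> (\<integral>z. f p z * f q z \<partial>gauss_noise) = 0"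
  shows "(\<integral>z. (\<Sum>p\<in>I. f p z)\<^sup>2 \<partial>gauss_noise) = (\<Sum>p\<in>I. \<integral>z. (f p z)\<^sup>2 \<partial>gauss_noise)"
  using assms
proof (induction I rule: finite_induct)
  case (insert p I)
  have *: "(\<lambda>z. \<Sum>q\<in>I. f q z) \<in> L2" "f p \<in> L2" using insert by (auto intro: L2_sum)
  have "(\<integral>z. f p z * (\<Sum>q\<in>I. f q z) \<partial>gauss_noise) = (\<Sum>q\<in>I. \<integral>z. f p z * f q z \<partial>gauss_noise)"
    unfolding sum_distrib_left using insert.prems by (intro Bochner_Integration.integral_sum L2_mult_integrable) auto
  also have "\<dots> = 0" using insert by (intro sum.neutral) auto
  finally show ?case
    using insert integral_square_add[OF *(2,1)] by simp
qed simp

lemma Bessel_inequality: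
  assumes "finite I" and f: "\<And>p. p \<in> I \<Longrightarrow> f p \<in> L2" and u: "u \<in> L2"
    and o: "\<And>p q. p \<in> I \<Longrightarrow> q \<in> I \<Longrightarrow> p \<noteq> q \<Longrightarrow> (\<integral>z. f p z * f q z \<partial>gauss_noise) = 0"
    and n: "\<And>p. p \<in> I \<Longrightarrow> (\<integral>z. (f p z)\<^sup>2 \<partial>gauss_noise) = 1"
  shows "(\<Sum>p\<in>I. (\<integral>z. u z * f p z \<partial>gauss_noise)\<^sup>2) \<le> (\<integral>z. (u z)\<^sup>2 \<partial>gauss_noise)"
proof -
  define c where "c p = (\<integral>z. u z * f p z \<partial>gauss_noise)" for p
  \<comment> \<open>\<open>v\<close> is minus the orthogonal projection of \<open>u\<close> onto the
    span of the \<open>f p\<close>; the inequality is nonnegativity of the squared norm of the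
    residual \<open>u + v\<close>.\<close>
  define v where "v z = (\<Sum>p\<in>I. - c p * f p z)" for z
  have v: "v \<in> L2" unfolding v_def by (intro L2_sum L2_scale f)
  have "(\<integral>z. (v z)\<^sup>2 \<partial>gauss_noise) = (\<Sum>p\<in>I. \<integral>z. (- c p * f p z)\<^sup>2 \<partial>gauss_noise)"
    unfolding v_def
  proof (rule integral_square_sum_orthogonal)
    fix p q assume "p \<in> I" "q \<in> I" "p \<noteq> q"
    then have "(\<integral>z. (c p * c q) * (f p z * f q z) \<partial>gauss_noise) = 0"
      unfolding integral_mult_right_zero using o by simp
    then show "(\<integral>z. - c p * f p z * (- c q * f q z) \<partial>gauss_noise) = 0" by (simp add: mult_ac)
  qed (auto intro!: assms L2_scale[of _ "- _", simplified])
  also have "\<dots> = (\<Sum>p\<in>I. (c p)\<^sup>2)"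
    using n by (intro sum.cong) (auto simp: power_mult_distrib)
  finally have vv: "(\<integral>z. (v z)\<^sup>2 \<partial>gauss_noise) = (\<Sum>p\<in>I. (c p)\<^sup>2)" .
  have "(\<integral>z. u z * v z \<partial>gauss_noise) = (\<integral>z. (\<Sum>p\<in>I. - c p * (u z * f p z)) \<partial>gauss_noise)"
    by (simp add: v_def sum_distrib_left mult_ac)
  also have "\<dots> = (\<Sum>p\<in>I. \<integral>z. - c p * (u z * f p z) \<partial>gauss_noise)"
    using u f by (intro Bochner_Integration.integral_sum integrable_mult_right L2_mult_integrable) auto
  also have "\<dots> = - (\<Sum>p\<in>I. (c p)\<^sup>2)"
    by (simp add: c_def power2_eq_square sum_negf)
  finally have "(\<integral>z. (u z + v z)\<^sup>2 \<partial>gauss_noise) = (\<integral>z. (u z)\<^sup>2 \<partial>gauss_noise) - (\<Sum>p\<in>I. (c p)\<^sup>2)"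
    using integral_square_add[OF u v] vv by simp
  moreover have "0 \<le> (\<integral>z. (u z + v z)\<^sup>2 \<partial>gauss_noise)" by simp
  ultimately show ?thesis by (simp add: c_def)
qed

section \<open>Parity and orthogonality of Gaussian monomials\<close>

definition flip :: "nat \<Rightarrow> seq" where
  "flip m = (\<lambda>i. if i = m then -1 else 1)"

lemma signs_flip [simp]: "signs (flip m)"
  by (simp add: signs_def flip_def)

text \<open>The flip preserves the law of the noise, so the integral equals its own
  negative.\<close>

lemma integral_odd_zero:
  fixes f :: "seq \<Rightarrow> real"
  assumes [measurable]: "f \<in> borel_measurable gauss_noise" and "\<And>z. f (\<lambda>i. flip m i * z i) = - f z"
  shows "(\<integral>z. f z \<partial>gauss_noise) = 0"
  using integral_gauss_signs[of "flip m" f] assms by simp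

lemma integral_coordinate_mult: "i \<noteq> j \<Longrightarrow> (\<integral>z. z i * z j \<partial>gauss_noise) = 0"
  by (rule integral_odd_zero[of _ i]) (auto simp: flip_def)

lemma integral_coordinate_mult_square:
  assumes "i \<noteq> j" shows "(\<integral>z. (z i * z j)\<^sup>2 \<partial>gauss_noise) = 1"
proof -
  have "(\<integral>z. (z i)\<^sup>2 * (z j)\<^sup>2 \<partial>gauss_noise) = (\<integral>z. (z i)\<^sup>2 \<partial>gauss_noise) * (\<integral>z. (z j)\<^sup>2 \<partial>gauss_noise)"
    by (rule integral_mult_depends_on[of "{i}" _ "{j}"]) (use assms in \<open>auto simp: depends_on_def\<close>)
  then show ?thesis by (simp add: power_mult_distrib gauss_moments)
qed

text \<open>Two different increasing pairs leave an index that occurs only once among the four: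
  \<open>i\<close> if it is not in the second pair, otherwise \<open>j\<close>. The product is odd
  in that coordinate.\<close>

lemma integral_pair_orthogonal:
  assumes "i < j" "k < l" "(i, j) \<noteq> (k, l)"
  shows "(\<integral>z. (z i * z j) * (z k * z l) \<partial>gauss_noise) = 0"
proof (cases "i = k \<or> i = l")
  case False
  then show ?thesis by (intro integral_odd_zero[of _ i]) (use assms in \<open>auto simp: flip_def\<close>)
next
  case True
  then have "j \<noteq> k" "j \<noteq> l" using assms by auto
  then show ?thesis by (intro integral_odd_zero[of _ j]) (use assms in \<open>auto simp: flip_def\<close>)
qed

lemma integral_square_linear:
  "(\<integral>z. (\<Sum>j<N. d j * z j)\<^sup>2 \<partial>gauss_noise) = (\<Sum>j<N. (d j)\<^sup>2)"
proof -
  have "(\<integral>z. (\<Sum>j<N. d j * z j)\<^sup>2 \<partial>gauss_noise) = (\<Sum>j<N. \<integral>z. (d j * z j)\<^sup>2 \<partial>gauss_noise)"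
  proof (rule integral_square_sum_orthogonal)
    fix p q :: nat assume "p \<noteq> q"
    then have "(\<integral>z. (d p * d q) * (z p * z q) \<partial>gauss_noise) = 0"
      unfolding integral_mult_right_zero by (simp add: integral_coordinate_mult)
    then show "(\<integral>z. d p * z p * (d q * z q) \<partial>gauss_noise) = 0" by (simp add: mult_ac)
  qed (auto intro!: L2_scale)
  then show ?thesis by (simp add: power_mult_distrib gauss_moments)
qed

text \<open>Only products with \<open>i < j\<close> survive, and these are orthonormal. Encoding the
  triangle by vanishing coefficients keeps all sums over full squares, matching
  \<open>qpart\<close>.\<close>

lemma integral_square_bilinear:
  assumes b: "\<And>i j. \<not> i < j \<Longrightarrow> b i j = 0"
  shows "(\<integral>z. (\<Sum>i<N. \<Sum>j<N. b i j * (z i * z j))\<^sup>2 \<partial>gauss_noise) = (\<Sum>i<N. \<Sum>j<N. (b i j)\<^sup>2)"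
proof -
  let ?f = "\<lambda>p z. b (fst p) (snd p) * (z (fst p) * z (snd p))"
  have "(\<integral>z. (\<Sum>p\<in>{..<N}\<times>{..<N}. ?f p z)\<^sup>2 \<partial>gauss_noise) = (\<Sum>p\<in>{..<N}\<times>{..<N}. \<integral>z. (?f p z)\<^sup>2 \<partial>gauss_noise)"
  proof (rule integral_square_sum_orthogonal)
    fix p q :: "nat \<times> nat" assume pq: "p \<noteq> q"
    show "(\<integral>z. ?f p z * ?f q z \<partial>gauss_noise) = 0"
    proof (cases "fst p < snd p \<and> fst q < snd q")
      case True
      then have "(\<integral>z. (b (fst p) (snd p) * b (fst q) (snd q)) * ((z (fst p) * z (snd p)) * (z (fst q) * z (snd q))) \<partial>gauss_noise) = 0"
        unfolding integral_mult_right_zero using pq by (subst integral_pair_orthogonal) (auto simp: prod_eq_iff)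
      then show ?thesis by (simp add: mult_ac)
    qed (auto simp: b)
  qed (auto intro!: L2_scale)
  also have "\<dots> = (\<Sum>p\<in>{..<N}\<times>{..<N}. (b (fst p) (snd p))\<^sup>2)"
  proof (rule sum.cong[OF refl])
    fix p :: "nat \<times> nat"
    show "(\<integral>z. (?f p z)\<^sup>2 \<partial>gauss_noise) = (b (fst p) (snd p))\<^sup>2"
      by (cases "fst p < snd p") (auto simp: b power_mult_distrib[of "b _ _"] integral_coordinate_mult_square)
  qed
  finally show ?thesis by (simp add: sum.cartesian_product case_prod_beta)
qed

text \<open>The point is a bound by the Hilbert-Schmidt norm of \<open>b\<close> with a factor that
  does not depend on \<open>N\<close>. The form is split by its degree in the noise into a constant,
  two linear terms and a bilinear one; Cauchy-Schwarz handles the weights coming from the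
  signal.\<close>

lemma integral_square_offdiagonal:
  fixes b :: "nat \<Rightarrow> nat \<Rightarrow> real" and \<theta> :: seq and s :: real and N :: nat
  assumes b: "\<And>i j. \<not> i < j \<Longrightarrow> b i j = 0" and \<theta>: "summable (\<lambda>i. (\<theta> i)\<^sup>2)"
  defines "u \<equiv> \<lambda>z. \<Sum>i<N. \<Sum>j<N. b i j * ((\<theta> i + s * z i) * (\<theta> j + s * z j))"
  shows "u \<in> L2"
    and "(\<integral>z. (u z)\<^sup>2 \<partial>gauss_noise) \<le> 4 * (Qf \<theta> + s\<^sup>2)\<^sup>2 * (\<Sum>i<N. \<Sum>j<N. (b i j)\<^sup>2)"
proof -
  define B where "B = (\<Sum>i<N. \<Sum>j<N. (b i j)\<^sup>2)"
  define T where "T = Qf \<theta>"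
  have T: "(\<Sum>i<N. (\<theta> i)\<^sup>2) \<le> T"
    unfolding T_def Qf_def by (rule sum_le_suminf[OF \<theta>]) auto
  have T0: "0 \<le> T" using T by (meson order_trans sum_nonneg zero_le_power2)
  define c0 where "c0 = (\<Sum>i<N. \<theta> i * (\<Sum>j<N. b i j * \<theta> j))"
  define l1 where "l1 z = (\<Sum>j<N. (s * (\<Sum>i<N. b i j * \<theta> i)) * z j)" for z :: seq
  define l2 where "l2 z = (\<Sum>i<N. (s * (\<Sum>j<N. b i j * \<theta> j)) * z i)" for z :: seq
  define q where "q z = (\<Sum>i<N. \<Sum>j<N. (s\<^sup>2 * b i j) * (z i * z j))" for z :: seq
  have l1': "l1 z = (\<Sum>i<N. \<Sum>j<N. b i j * \<theta> i * (s * z j))" for z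
    unfolding l1_def by (subst sum.swap) (simp add: sum_distrib_left sum_distrib_right mult_ac)
  have u: "u z = c0 + l1 z + l2 z + q z" for z
    unfolding u_def c0_def l1' l2_def q_def sum_distrib_left sum_distrib_right sum.distrib[symmetric]
    by (intro sum.cong refl) (simp add: algebra_simps power2_eq_square)
  have m: "l1 \<in> L2" "l2 \<in> L2" "q \<in> L2"
    unfolding l1_def l2_def q_def by (auto intro!: L2_sum L2_scale)
  then show "u \<in> L2" unfolding u[abs_def] by (intro L2_add) auto
  have cs: "(\<Sum>j<N. x j * \<theta> j)\<^sup>2 \<le> (\<Sum>j<N. (x j)\<^sup>2) * T" for x
    using Cauchy_Schwarz_ineq_sum[of x \<theta> "{..<N}"] T
    by (meson mult_left_mono order_trans sum_nonneg zero_le_power2)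
  have row: "(\<Sum>i<N. (\<Sum>j<N. b i j * \<theta> j)\<^sup>2) \<le> B * T"
    unfolding B_def sum_distrib_right by (intro sum_mono order_trans[OF cs]) (simp add: sum_distrib_right)
  have col: "(\<Sum>j<N. (\<Sum>i<N. b i j * \<theta> i)\<^sup>2) \<le> B * T"
    unfolding B_def by (subst sum.swap) (auto simp: sum_distrib_right intro!: sum_mono order_trans[OF cs])
  have "c0\<^sup>2 \<le> (\<Sum>i<N. (\<Sum>j<N. b i j * \<theta> j)\<^sup>2) * T"
    using cs[of "\<lambda>i. \<Sum>j<N. b i j * \<theta> j"] by (simp add: c0_def mult.commute)
  also have "\<dots> \<le> B * T * T" by (intro mult_right_mono row T0)
  finally have c0: "c0\<^sup>2 \<le> B * T * T" .
  have L1: "(\<integral>z. (l1 z)\<^sup>2 \<partial>gauss_noise) \<le> s\<^sup>2 * (B * T)"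
    unfolding l1_def integral_square_linear power_mult_distrib sum_distrib_left[symmetric]
    by (intro mult_left_mono col) auto
  have L2: "(\<integral>z. (l2 z)\<^sup>2 \<partial>gauss_noise) \<le> s\<^sup>2 * (B * T)"
    unfolding l2_def integral_square_linear power_mult_distrib sum_distrib_left[symmetric]
    by (intro mult_left_mono row) auto
  have Q: "(\<integral>z. (q z)\<^sup>2 \<partial>gauss_noise) = s ^ 4 * B"
    unfolding q_def by (subst integral_square_bilinear) (auto simp: b B_def power_mult_distrib sum_distrib_left)
  have sq4: "(w + x + y + v)\<^sup>2 \<le> 4 * (w\<^sup>2 + x\<^sup>2 + y\<^sup>2 + v\<^sup>2)" for w x y v :: real
    using zero_le_power2[of "w - x"] zero_le_power2[of "w - y"] zero_le_power2[of "w - v"]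
      zero_le_power2[of "x - y"] zero_le_power2[of "x - v"] zero_le_power2[of "y - v"]
    unfolding power2_eq_square by (simp add: algebra_simps)
  have "(\<integral>z. (u z)\<^sup>2 \<partial>gauss_noise) \<le> (\<integral>z. 4 * (c0\<^sup>2 + (l1 z)\<^sup>2 + (l2 z)\<^sup>2 + (q z)\<^sup>2) \<partial>gauss_noise)"
    by (rule integral_mono) (use m \<open>u \<in> L2\<close> in \<open>auto simp: L2_integrable_square u[symmetric] simp del: distrib_left_numeral intro!: order_trans[OF eq_refl sq4] u[THEN arg_cong]\<close>)
  also have "\<dots> = 4 * (c0\<^sup>2 + (\<integral>z. (l1 z)\<^sup>2 \<partial>gauss_noise) + (\<integral>z. (l2 z)\<^sup>2 \<partial>gauss_noise) + (\<integral>z. (q z)\<^sup>2 \<partial>gauss_noise))"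
    using m by (simp add: L2_integrable_square gauss.prob_space)
  also have "\<dots> \<le> 4 * (B * T * T + s\<^sup>2 * (B * T) + s\<^sup>2 * (B * T) + s ^ 4 * B)"
    by (intro mult_left_mono add_mono c0 L1 L2 eq_refl[OF Q]) simp
  \<comment> \<open>The factor 4 counts the four terms of the splitting; their bounds add up to a
    perfect square in \<open>T\<close> and \<open>s\<^sup>2\<close>.\<close>
  also have "\<dots> = 4 * (T + s\<^sup>2)\<^sup>2 * B" by (simp add: power2_eq_square power4_eq_xxxx algebra_simps)
  finally show "(\<integral>z. (u z)\<^sup>2 \<partial>gauss_noise) \<le> 4 * (Qf \<theta> + s\<^sup>2)\<^sup>2 * (\<Sum>i<N. \<Sum>j<N. (b i j)\<^sup>2)"
    by (simp add: B_def T_def)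
qed

section \<open>Series of independent centred terms\<close>

lemma depends_on_comp: "depends_on I f \<Longrightarrow> depends_on I (\<lambda>z. h (f z))"
  unfolding depends_on_def by metis

lemma gauss_events: "Measurable.pred gauss_noise P \<Longrightarrow> {z. P z} \<in> gauss.events"
  by (simp add: pred_def)

lemma square_integral_le:
  assumes "f \<in> L2"
  shows "(\<integral>z. f z \<partial>gauss_noise)\<^sup>2 \<le> (\<integral>z. (f z)\<^sup>2 \<partial>gauss_noise)"
proof -
  define c where "c = (\<integral>z. f z \<partial>gauss_noise)"
  have "(\<integral>z. f z * - c \<partial>gauss_noise) = - c\<^sup>2" by (simp add: c_def power2_eq_square)
  moreover have "(\<integral>z. (f z + - c)\<^sup>2 \<partial>gauss_noise)
      = (\<integral>z. (f z)\<^sup>2 \<partial>gauss_noise) + 2 * (\<integral>z. f z * - c \<partial>gauss_noise) + c\<^sup>2"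
    using integral_square_add[OF assms L2_const[of "- c"]] by simp
  moreover have "0 \<le> (\<integral>z. (f z + - c)\<^sup>2 \<partial>gauss_noise)" by simp
  ultimately show ?thesis unfolding c_def[symmetric] by linarith
qed

text \<open>Fatou's lemma applied to the squares: a uniform second moment bound survives almost sure
  convergence, which is the only convergence that the definition of the risk supplies.\<close>

lemma
  assumes f: "\<And>N::nat. f N \<in> L2" and c: "\<And>N. (\<integral>z. (f N z)\<^sup>2 \<partial>gauss_noise) \<le> c"
    and [measurable]: "u \<in> borel_measurable gauss_noise"
    and lim: "AE z in gauss_noise. (\<lambda>N. f N z) \<longlonglongrightarrow> u z"
  shows L2_Fatou: "u \<in> L2" and integral_square_Fatou: "(\<integral>z. (u z)\<^sup>2 \<partial>gauss_noise) \<le> c"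
proof -
  have c0: "0 \<le> c" using c[of 0] by (rule order_trans[rotated]) simp
  have "(\<integral>\<^sup>+z. ennreal ((u z)\<^sup>2) \<partial>gauss_noise) = (\<integral>\<^sup>+z. liminf (\<lambda>N. ennreal ((f N z)\<^sup>2)) \<partial>gauss_noise)"
  proof (rule nn_integral_cong_AE, use lim in eventually_elim)
    fix z assume "(\<lambda>N. f N z) \<longlonglongrightarrow> u z"
    then have "(\<lambda>N. ennreal ((f N z)\<^sup>2)) \<longlonglongrightarrow> ennreal ((u z)\<^sup>2)"
      by (intro tendsto_ennrealI tendsto_power)
    then show "ennreal ((u z)\<^sup>2) = liminf (\<lambda>N. ennreal ((f N z)\<^sup>2))"
      by (intro lim_imp_Liminf[symmetric]) auto
  qed
  also have "\<dots> \<le> liminf (\<lambda>N. \<integral>\<^sup>+z. ennreal ((f N z)\<^sup>2) \<partial>gauss_noise)"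
    by (rule nn_integral_liminf) (use f in measurable)
  also have "\<dots> \<le> liminf (\<lambda>N::nat. ennreal c)"
    by (intro Liminf_mono always_eventually allI) (simp add: nn_integral_L2 f c ennreal_leI)
  also have "\<dots> = ennreal c" by (rule Liminf_const) simp
  finally have *: "(\<integral>\<^sup>+z. ennreal ((u z)\<^sup>2) \<partial>gauss_noise) \<le> ennreal c" .
  show "u \<in> L2" "(\<integral>z. (u z)\<^sup>2 \<partial>gauss_noise) \<le> c"
    using L2_nn_integralI[OF _ * c0] integral_square_le[OF _ * c0] by auto
qed

text \<open>The partial sums frozen once they reach the level \<open>l\<close>. Since the stopped sums still have orthogonal
  increments, Chebyshev's inequality for them is Kolmogorov's maximal inequality.\<close>

fun stopped :: "real \<Rightarrow> (nat \<Rightarrow> real \<Rightarrow> real) \<Rightarrow> nat \<Rightarrow> seq \<Rightarrow> real" where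
  "stopped l g 0 z = 0"
| "stopped l g (Suc k) z = stopped l g k z + (if l \<le> \<bar>stopped l g k z\<bar> then 0 else g k (z k))"

text \<open>Each \<open>g i\<close> is a function of a single coordinate, so the terms
  \<open>g i (z i)\<close> are independent by construction.\<close>

locale centered =
  fixes g :: "nat \<Rightarrow> real \<Rightarrow> real"
  assumes meas [measurable]: "\<And>i. g i \<in> borel_measurable borel"
    and in_L2: "\<And>i. (\<lambda>z. g i (z i)) \<in> L2"
    and mean: "\<And>i. (\<integral>z. g i (z i) \<partial>gauss_noise) = 0"
begin

definition var :: "nat \<Rightarrow> real" where
  "var i = (\<integral>z. (g i (z i))\<^sup>2 \<partial>gauss_noise)"

lemma var_nonneg [simp]: "0 \<le> var i"
  by (simp add: var_def)

lemma integral_square_sum: "finite I \<Longrightarrow> (\<integral>z. (\<Sum>i\<in>I. g i (z i))\<^sup>2 \<partial>gauss_noise) = (\<Sum>i\<in>I. var i)"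
  unfolding var_def
proof (rule integral_square_sum_orthogonal)
  fix p q :: nat assume "p \<noteq> q"
  then have "(\<integral>z. g p (z p) * g q (z q) \<partial>gauss_noise) = (\<integral>z. g p (z p) \<partial>gauss_noise) * (\<integral>z. g q (z q) \<partial>gauss_noise)"
    by (intro integral_mult_depends_on[of "{p}" _ "{q}"] L2_integrable in_L2) (auto simp: depends_on_def)
  then show "(\<integral>z. g p (z p) * g q (z q) \<partial>gauss_noise) = 0" by (simp add: mean)
qed (auto intro: in_L2)

lemma measurable_stopped [measurable]: "stopped l g k \<in> borel_measurable gauss_noise"
  by (induction k) simp_all

lemma depends_on_stopped: "depends_on {..<k} (stopped l g k)"
proof (induction k)
  case (Suc k)
  show ?case unfolding depends_on_def
  proof (intro allI impI)
    fix z z' :: seq assume z: "\<forall>i\<in>{..<Suc k}. z i = z' i"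
    then have "stopped l g k z = stopped l g k z'"
      using Suc by (auto simp: depends_on_def)
    with z show "stopped l g (Suc k) z = stopped l g (Suc k) z'" by simp
  qed
qed (simp add: depends_on_def)

text \<open>Whether step \<open>k\<close> is frozen is decided by the coordinates below
  \<open>k\<close>, so the increment is a factor depending on the past times the independent centred
  term \<open>g k (z k)\<close>. The cross term vanishes, and the 0/1 factor can only lower the
  variance.\<close>

lemma stopped_variance: "stopped l g k \<in> L2 \<and> (\<integral>z. (stopped l g k z)\<^sup>2 \<partial>gauss_noise) \<le> (\<Sum>i<k. var i)"
proof (induction k)
  case 0
  have "stopped l g 0 = (\<lambda>_. 0)" by (simp add: fun_eq_iff)
  then show ?case by simp
next
  case (Suc k)
  define one where "one z = (if l \<le> \<bar>stopped l g k z\<bar> then 0 else 1 :: real)" for z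
  have [measurable]: "one \<in> borel_measurable gauss_noise" unfolding one_def by measurable
  define x where "x z = one z * g k (z k)" for z
  have [measurable]: "x \<in> borel_measurable gauss_noise" unfolding x_def by measurable
  have x: "x \<in> L2"
    by (rule L2_bound[OF in_L2[of k]]) (auto simp: x_def one_def)
  have eq: "stopped l g (Suc k) z = stopped l g k z + x z" for z
    by (simp add: x_def one_def)
  have t: "stopped l g k \<in> L2" using Suc by simp
  have s1: "(\<lambda>z. stopped l g k z * one z) \<in> L2"
    by (rule L2_bound[OF t]) (auto simp: one_def)
  have "(\<integral>z. stopped l g k z * x z \<partial>gauss_noise) = (\<integral>z. (stopped l g k z * one z) * g k (z k) \<partial>gauss_noise)"
    by (simp add: x_def mult_ac)
  also have "\<dots> = (\<integral>z. stopped l g k z * one z \<partial>gauss_noise) * (\<integral>z. g k (z k) \<partial>gauss_noise)"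
  proof (rule integral_mult_depends_on[of "{..<k}" _ "{k}"])
    show "depends_on {..<k} (\<lambda>z. stopped l g k z * one z)"
      unfolding one_def by (rule depends_on_comp[OF depends_on_stopped])
    show "depends_on {k} (\<lambda>z. g k (z k))" by (simp add: depends_on_def)
  qed (use s1 in_L2 in \<open>auto intro: L2_integrable\<close>)
  finally have c: "(\<integral>z. stopped l g k z * x z \<partial>gauss_noise) = 0" by (simp add: mean)
  have "(\<integral>z. (x z)\<^sup>2 \<partial>gauss_noise) \<le> var k"
    unfolding var_def
    by (rule integral_mono[OF L2_integrable_square[OF x] L2_integrable_square[OF in_L2]]) (auto simp: x_def one_def)
  then show ?case
    using integral_square_add[OF t x] Suc c L2_add[OF t x] unfolding eq[abs_def] by simp
qed

text \<open>The equality with the plain partial sum is carried along while the level has not been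
  reached; the induction needs it to recognise the first crossing, after which the value is
  frozen.\<close>

lemma stopped_large:
  "(\<forall>j\<le>k. \<bar>\<Sum>i<j. g i (z i)\<bar> < l) \<and> stopped l g k z = (\<Sum>i<k. g i (z i)) \<or> l \<le> \<bar>stopped l g k z\<bar>"
proof (induction k)
  case (Suc k)
  then show ?case
  proof
    assume "(\<forall>j\<le>k. \<bar>\<Sum>i<j. g i (z i)\<bar> < l) \<and> stopped l g k z = (\<Sum>i<k. g i (z i))"
    then show ?thesis by (cases "l \<le> \<bar>\<Sum>i<k. g i (z i)\<bar>"; cases "l \<le> \<bar>\<Sum>i<Suc k. g i (z i)\<bar>") (auto simp: le_Suc_eq)
  qed simp
next
  case 0
  then show ?case by (cases "l \<le> 0") auto
qed

lemma Kolmogorov_maximal_inequality: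
  assumes l: "l > 0"
  shows "gauss.prob {z. \<exists>j\<le>k. l \<le> \<bar>\<Sum>i<j. g i (z i)\<bar>} \<le> (\<Sum>i<k. var i) / l\<^sup>2"
proof -
  have "gauss.prob {z. \<exists>j\<le>k. l \<le> \<bar>\<Sum>i<j. g i (z i)\<bar>} \<le> gauss.prob {z\<in>space gauss_noise. l\<^sup>2 \<le> (stopped l g k z)\<^sup>2}"
  proof (rule gauss.finite_measure_mono)
    show "{z. \<exists>j\<le>k. l \<le> \<bar>\<Sum>i<j. g i (z i)\<bar>} \<subseteq> {z\<in>space gauss_noise. l\<^sup>2 \<le> (stopped l g k z)\<^sup>2}"
    proof
      fix z assume "z \<in> {z. \<exists>j\<le>k. l \<le> \<bar>\<Sum>i<j. g i (z i)\<bar>}"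
      then have "l \<le> \<bar>stopped l g k z\<bar>" using stopped_large[of k z l] by (auto simp: not_less[symmetric])
      then show "z \<in> {z\<in>space gauss_noise. l\<^sup>2 \<le> (stopped l g k z)\<^sup>2}"
        using l by (simp add: abs_le_square_iff[symmetric])
    qed
    show "{z\<in>space gauss_noise. l\<^sup>2 \<le> (stopped l g k z)\<^sup>2} \<in> gauss.events" by measurable
  qed
  also have "\<dots> \<le> (\<integral>z. (stopped l g k z)\<^sup>2 \<partial>gauss_noise) / l\<^sup>2"
    by (rule integral_Markov_inequality_measure[of _ _ "{}"]) (use stopped_variance l in \<open>auto simp: L2_integrable_square\<close>)
  also have "\<dots> \<le> (\<Sum>i<k. var i) / l\<^sup>2"
    using stopped_variance by (intro divide_right_mono) auto
  finally show ?thesis .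
qed

end

text \<open>Zeroing the first \<open>m\<close> terms instead of shifting the index keeps every term
  attached to its own noise coordinate.\<close>

lemma (in centered) centered_tail: "centered (\<lambda>i x. if i < m then 0 else g i x)"
proof
  fix i
  show "(\<lambda>x. if i < m then 0 else g i x) \<in> borel_measurable borel" by simp
  show "(\<lambda>z. if i < m then 0 else g i (z i)) \<in> L2" using in_L2[of i] by (cases "i < m") auto
  show "(\<integral>z. (if i < m then 0 else g i (z i)) \<partial>gauss_noise) = 0" using mean[of i] by (cases "i < m") auto
qed

text \<open>The maximal inequality with horizon \<open>k\<close> has a bound free of
  \<open>k\<close>, so continuity from below along the increasing events extends it to all later
  partial sums at once.\<close>

lemma (in centered) maximal_inequality_tail:
  assumes l: "l > 0" and var: "summable var"
  shows "gauss.prob {z. \<exists>j\<ge>m. l \<le> \<bar>(\<Sum>i<j. g i (z i)) - (\<Sum>i<m. g i (z i))\<bar>} \<le> (\<Sum>i. var (i + m)) / l\<^sup>2"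
proof -
  interpret tail: centered "\<lambda>i x. if i < m then 0 else g i x" by (rule centered_tail)
  define E where "E k = {z. \<exists>j\<le>k. l \<le> \<bar>\<Sum>i<j. if i < m then 0 else g i (z i)\<bar>}" for k
  have E: "E k \<in> gauss.events" for k
    unfolding E_def by (rule gauss_events) measurable
  have sum_eq: "(\<Sum>i<j. if i < m then 0 else g i (z i)) = (\<Sum>i<j. g i (z i)) - (\<Sum>i<m. g i (z i))" if "m \<le> j" for j z
    using that by (induction j rule: dec_induct) (auto intro!: sum.neutral)
  have "{z. \<exists>j\<ge>m. l \<le> \<bar>(\<Sum>i<j. g i (z i)) - (\<Sum>i<m. g i (z i))\<bar>} \<subseteq> (\<Union>k. E k)"
  proof
    fix z assume "z \<in> {z. \<exists>j\<ge>m. l \<le> \<bar>(\<Sum>i<j. g i (z i)) - (\<Sum>i<m. g i (z i))\<bar>}"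
    then obtain j where "m \<le> j" "l \<le> \<bar>(\<Sum>i<j. g i (z i)) - (\<Sum>i<m. g i (z i))\<bar>" by auto
    then have "z \<in> E j" unfolding E_def using sum_eq[of j z] by auto
    then show "z \<in> (\<Union>k. E k)" by blast
  qed
  then have "gauss.prob {z. \<exists>j\<ge>m. l \<le> \<bar>(\<Sum>i<j. g i (z i)) - (\<Sum>i<m. g i (z i))\<bar>} \<le> gauss.prob (\<Union>k. E k)"
    using E by (intro gauss.finite_measure_mono) auto
  also have "\<dots> \<le> (\<Sum>i. var (i + m)) / l\<^sup>2"
  proof (rule LIMSEQ_le_const2)
    show "(\<lambda>k. gauss.prob (E k)) \<longlonglongrightarrow> gauss.prob (\<Union>k. E k)"
      by (rule gauss.finite_Lim_measure_incseq) (use E in \<open>auto simp: incseq_def E_def intro: order_trans\<close>)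
    have "gauss.prob (E k) \<le> (\<Sum>i. var (i + m)) / l\<^sup>2" for k
    proof -
      have "tail.var i = (if i < m then 0 else var i)" for i by (simp add: tail.var_def var_def)
      then have "(\<Sum>i<k. tail.var i) = (\<Sum>i<k. if i < m then 0 else var i)" by simp
      also have "\<dots> = (\<Sum>i\<in>{m..<k}. var i)"
        by (rule sum.mono_neutral_cong_right) auto
      also have "\<dots> = (\<Sum>i<k-m. var (i + m))"
        using sum.shift_bounds_nat_ivl[of var 0 m "k - m"] by (cases "m \<le> k") (auto simp: atLeast0LessThan)
      also have "\<dots> \<le> (\<Sum>i. var (i + m))"
        using var by (intro sum_le_suminf) (auto simp: summable_iff_shift)
      finally show ?thesis
        using tail.Kolmogorov_maximal_inequality[OF l, of k] by (simp add: E_def divide_right_mono order_trans)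
    qed
    then show "\<exists>N. \<forall>k\<ge>N. gauss.prob (E k) \<le> (\<Sum>i. var (i + m)) / l\<^sup>2" by blast
  qed
  finally show ?thesis .
qed

theorem (in centered) AE_convergent:
  assumes var: "summable var"
  shows "AE z in gauss_noise. convergent (\<lambda>N. \<Sum>i<N. g i (z i))"
proof -
  define S where "S N z = (\<Sum>i<N. g i (z i))" for N and z :: seq
  have [measurable]: "S N \<in> borel_measurable gauss_noise" for N unfolding S_def by measurable
  have "AE z in gauss_noise. \<exists>m. \<forall>j\<ge>m. \<bar>S j z - S m z\<bar> < l" if l: "l > 0" for l
  proof -
    \<comment> \<open>\<open>F\<close> lies in the deviation event for every starting index
      \<open>m\<close>, and the probabilities of these events are bounded by variance tails that
      tend to 0.\<close>
    define F where "F = {z. \<forall>m. \<exists>j\<ge>m. l \<le> \<bar>S j z - S m z\<bar>}"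
    have F: "F \<in> gauss.events"
      unfolding F_def by (rule gauss_events) measurable
    have "gauss.prob F \<le> (\<Sum>i. var (i + m)) / l\<^sup>2" for m
    proof -
      have "{z. \<exists>j\<ge>m. l \<le> \<bar>S j z - S m z\<bar>} \<in> gauss.events" by (rule gauss_events) measurable
      then have "gauss.prob F \<le> gauss.prob {z. \<exists>j\<ge>m. l \<le> \<bar>S j z - S m z\<bar>}"
        by (intro gauss.finite_measure_mono) (auto simp: F_def)
      then show ?thesis using maximal_inequality_tail[OF l var, of m] by (simp add: S_def)
    qed
    moreover have "(\<lambda>m. (\<Sum>i. var (i + m)) / l\<^sup>2) \<longlonglongrightarrow> 0 / l\<^sup>2"
      by (intro tendsto_divide suminf_exist_split2 var tendsto_const) (use l in auto)
    ultimately have "gauss.prob F \<le> 0 / l\<^sup>2"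
      by (intro LIMSEQ_le_const[of _ _ "gauss.prob F"]) auto
    then have "gauss.prob F = 0" by (simp add: measure_le_0_iff)
    then have "F \<in> null_sets gauss_noise" using F by (simp add: gauss.emeasure_eq_measure null_sets_def)
    then show ?thesis by (rule AE_I') (auto simp: F_def not_less)
  qed
  then have "AE z in gauss_noise. \<forall>r::nat. \<exists>m. \<forall>j\<ge>m. \<bar>S j z - S m z\<bar> < 1 / Suc r"
    by (simp add: AE_all_countable)
  then show ?thesis
  proof (rule AE_mp, intro AE_I2 impI)
    fix z assume *: "\<forall>r::nat. \<exists>m. \<forall>j\<ge>m. \<bar>S j z - S m z\<bar> < 1 / Suc r"
    have "Cauchy (\<lambda>N. S N z)"
      unfolding Cauchy_altdef2
    proof (intro allI impI)
      fix e :: real assume "e > 0"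
      then obtain r :: nat where "inverse (Suc r) < e" using reals_Archimedean by blast
      with * show "\<exists>m. \<forall>j\<ge>m. dist (S j z) (S m z) < e"
        unfolding dist_real_def by (metis inverse_eq_divide less_trans)
    qed
    then show "convergent (\<lambda>N. \<Sum>i<N. g i (z i))" by (simp add: Cauchy_convergent_iff S_def)
  qed
qed

text \<open>The mean is 0 because it equals the mean of every remainder, whose second moment tends
  to 0. For the second moment, Fatou gives the upper bound, and orthogonality of partial sum and
  remainder gives the lower one.\<close>

lemma (in centered)
  assumes var: "summable var" and [measurable]: "u \<in> borel_measurable gauss_noise"
    and u: "AE z in gauss_noise. (\<lambda>N. \<Sum>i<N. g i (z i)) \<longlonglongrightarrow> u z"
  shows L2_limit: "u \<in> L2"
    and integral_limit: "(\<integral>z. u z \<partial>gauss_noise) = 0"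
    and integral_square_limit: "(\<integral>z. (u z)\<^sup>2 \<partial>gauss_noise) = (\<Sum>i. var i)"
proof -
  define S where "S N z = (\<Sum>i<N. g i (z i))" for N and z :: seq
  have S: "S N \<in> L2" for N unfolding S_def by (intro L2_sum in_L2)
  have [measurable]: "S N \<in> borel_measurable gauss_noise" for N using S by simp
  have S_int: "(\<integral>z. S N z \<partial>gauss_noise) = 0" for N
    unfolding S_def by (subst Bochner_Integration.integral_sum) (auto simp: mean intro: L2_integrable in_L2)
  have S2: "(\<integral>z. (S N z)\<^sup>2 \<partial>gauss_noise) = (\<Sum>i<N. var i)" for N
    unfolding S_def by (rule integral_square_sum) simp
  have lim: "AE z in gauss_noise. (\<lambda>N. S N z) \<longlonglongrightarrow> u z" using u by (simp add: S_def)
  have Sle: "(\<integral>z. (S N z)\<^sup>2 \<partial>gauss_noise) \<le> (\<Sum>i. var i)" for N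
    unfolding S2 by (rule sum_le_suminf[OF var]) auto
  show uL2: "u \<in> L2" by (rule L2_Fatou[OF S Sle _ lim]) simp
  have upper: "(\<integral>z. (u z)\<^sup>2 \<partial>gauss_noise) \<le> (\<Sum>i. var i)"
    by (rule integral_square_Fatou[OF S Sle _ lim]) simp
  define r where "r N z = u z - S N z" for N z
  have r: "r N \<in> L2" for N unfolding r_def by (intro L2_diff uL2 S)
  have r2: "(\<integral>z. (r N z)\<^sup>2 \<partial>gauss_noise) \<le> (\<Sum>i. var (i + N))" for N
  proof (rule integral_square_Fatou)
    have eq: "S (k + N) z - S N z = (\<Sum>i\<in>{N..<k + N}. g i (z i))" for k z
      unfolding S_def by (subst sum_diff_nat_ivl[symmetric, of 0 N]) (auto simp: atLeast0LessThan)
    show "(\<lambda>z. S (k + N) z - S N z) \<in> L2" for k by (intro L2_diff S)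
    show "(\<integral>z. (S (k + N) z - S N z)\<^sup>2 \<partial>gauss_noise) \<le> (\<Sum>i. var (i + N))" for k
    proof -
      have "(\<integral>z. (S (k + N) z - S N z)\<^sup>2 \<partial>gauss_noise) = (\<Sum>i\<in>{0 + N..<k + N}. var i)"
        unfolding eq by (subst integral_square_sum) auto
      also have "\<dots> = (\<Sum>i<k. var (i + N))"
        unfolding sum.shift_bounds_nat_ivl by (simp add: atLeast0LessThan)
      also have "\<dots> \<le> (\<Sum>i. var (i + N))"
        using var by (intro sum_le_suminf) (auto simp: summable_iff_shift)
      finally show ?thesis .
    qed
    show "AE z in gauss_noise. (\<lambda>k. S (k + N) z - S N z) \<longlonglongrightarrow> r N z"
      using lim unfolding r_def by eventually_elim (intro tendsto_diff tendsto_const LIMSEQ_ignore_initial_segment)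
  qed (simp add: r_def)
  have tail0: "(\<lambda>N. \<Sum>i. var (i + N)) \<longlonglongrightarrow> 0" by (rule suminf_exist_split2[OF var])
  have ru: "(\<integral>z. r N z \<partial>gauss_noise) = (\<integral>z. u z \<partial>gauss_noise)" for N
    unfolding r_def using uL2 S by (simp add: L2_integrable S_int)
  have "(\<integral>z. u z \<partial>gauss_noise)\<^sup>2 \<le> (\<Sum>i. var (i + N))" for N
    using square_integral_le[OF r[of N]] r2[of N] by (simp add: ru)
  then have "(\<integral>z. u z \<partial>gauss_noise)\<^sup>2 \<le> 0" by (intro LIMSEQ_le_const[OF tail0]) auto
  then show "(\<integral>z. u z \<partial>gauss_noise) = 0" by simp
  have orth: "(\<integral>z. S N z * r N z \<partial>gauss_noise) = 0" for N
  proof -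
    \<comment> \<open>\<open>u\<close> is only an almost sure limit, so \<open>r N\<close> need not
      be a function of the coordinates from \<open>N\<close> on. \<open>r'\<close> is a version that
      is one everywhere, including where \<open>lim\<close> takes its default value.\<close>
    define r' where "r' z = lim (\<lambda>k. \<Sum>i\<in>{N..<k}. g i (z i))" for z :: seq
    have [measurable]: "r' \<in> borel_measurable gauss_noise" unfolding r'_def by measurable
    have ae: "AE z in gauss_noise. r N z = r' z"
      using lim
    proof eventually_elim
      case (elim z)
      have "(\<lambda>k. S k z - S N z) \<longlonglongrightarrow> r N z"
        unfolding r_def by (intro tendsto_diff tendsto_const elim)
      moreover have "\<forall>\<^sub>F k in sequentially. S k z - S N z = (\<Sum>i\<in>{N..<k}. g i (z i))"
        using eventually_ge_at_top[of N]
        by eventually_elim (auto simp: S_def atLeast0LessThan[symmetric] sum_diff_nat_ivl)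
      ultimately have "(\<lambda>k. \<Sum>i\<in>{N..<k}. g i (z i)) \<longlonglongrightarrow> r N z"
        by (rule Lim_transform_eventually)
      then show ?case unfolding r'_def by (simp add: limI)
    qed
    have r': "r' \<in> L2" by (rule L2_cong_AE[OF r _ ae]) simp
    have "(\<integral>z. S N z * r N z \<partial>gauss_noise) = (\<integral>z. S N z * r' z \<partial>gauss_noise)"
      by (rule integral_cong_AE) (use ae r r' S in \<open>auto\<close>)
    also have "\<dots> = (\<integral>z. S N z \<partial>gauss_noise) * (\<integral>z. r' z \<partial>gauss_noise)"
    proof (rule integral_mult_depends_on[of "{..<N}" _ "{N..}"])
      show "depends_on {..<N} (S N)" by (auto simp: depends_on_def S_def)
      show "depends_on {N..} r'"
        unfolding depends_on_def r'_def by (intro allI impI arg_cong[where f = lim] ext sum.cong) auto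
    qed (use r' S in \<open>auto intro: L2_integrable\<close>)
    finally show ?thesis by (simp add: S_int)
  qed
  have "(\<Sum>i<N. var i) \<le> (\<integral>z. (u z)\<^sup>2 \<partial>gauss_noise)" for N
    using integral_square_add[OF S[of N] r[of N]] orth[of N] unfolding S2 by (simp add: r_def)
  then have "(\<Sum>i. var i) \<le> (\<integral>z. (u z)\<^sup>2 \<partial>gauss_noise)"
    by (intro suminf_le_const var)
  with upper show "(\<integral>z. (u z)\<^sup>2 \<partial>gauss_noise) = (\<Sum>i. var i)" by simp
qed

section \<open>Sign averaging of quadratic forms\<close>

lemma measurable_qpart [measurable]:
  assumes [measurable]: "\<And>i. (\<lambda>z. y z i) \<in> borel_measurable M"
  shows "(\<lambda>z. qpart A (y z) N) \<in> borel_measurable M"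
  unfolding qpart_def by measurable

text \<open>A quadratic form sees only \<open>A i j + A j i\<close>; collecting both entries above
  the diagonal makes each unordered pair occur once, as orthogonality requires.\<close>

definition offdiag :: "(nat \<Rightarrow> nat \<Rightarrow> real) \<Rightarrow> nat \<Rightarrow> nat \<Rightarrow> real" where
  "offdiag A i j = (if i < j then A i j + A j i else 0)"

lemma qpart_split:
  "qpart A y N = (\<Sum>i<N. A i i * (y i)\<^sup>2) + (\<Sum>i<N. \<Sum>j<N. offdiag A i j * (y i * y j))"
proof -
  have "(\<Sum>i<N. \<Sum>j<N. if j < i then A i j * y i * y j else 0) = (\<Sum>i<N. \<Sum>j<N. if i < j then A j i * y j * y i else 0)"
    by (rule sum.swap)
  moreover have "qpart A y N = (\<Sum>i<N. \<Sum>j<N. (if i = j then A i i * (y i)\<^sup>2 else 0)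
      + (if i < j then A i j * y i * y j else 0) + (if j < i then A i j * y i * y j else 0))"
    unfolding qpart_def by (intro sum.cong refl) (auto simp: power2_eq_square)
  ultimately have "qpart A y N = (\<Sum>i<N. \<Sum>j<N. (if i = j then A i i * (y i)\<^sup>2 else 0))
      + ((\<Sum>i<N. \<Sum>j<N. if i < j then A i j * y i * y j else 0) + (\<Sum>i<N. \<Sum>j<N. if i < j then A j i * y j * y i else 0))"
    by (simp add: sum.distrib)
  also have "(\<Sum>i<N. \<Sum>j<N. (if i = j then A i i * (y i)\<^sup>2 else 0)) = (\<Sum>i<N. A i i * (y i)\<^sup>2)"
    by (intro sum.cong) auto
  also have "(\<Sum>i<N. \<Sum>j<N. if i < j then A i j * y i * y j else 0) + (\<Sum>i<N. \<Sum>j<N. if i < j then A j i * y j * y i else 0)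
      = (\<Sum>i<N. \<Sum>j<N. offdiag A i j * (y i * y j))"
    unfolding sum.distrib[symmetric] by (intro sum.cong refl) (auto simp: offdiag_def algebra_simps)
  finally show ?thesis .
qed

text \<open>These are the coefficients left after averaging over the signs of the observations below
  \<open>K\<close>: such an observation keeps its square and loses all its products with
  others.\<close>

definition strip :: "nat \<Rightarrow> (nat \<Rightarrow> nat \<Rightarrow> real) \<Rightarrow> nat \<Rightarrow> nat \<Rightarrow> real" where
  "strip K A i j = (if i = j \<or> (K \<le> i \<and> K \<le> j) then A i j else 0)"

lemma strip_0 [simp]: "strip 0 A = A"
  by (simp add: strip_def fun_eq_iff)

lemma strip_diag [simp]: "strip K A i i = A i i"
  by (simp add: strip_def)

lemma offdiag_strip: "offdiag (strip K A) i j = (if K \<le> i \<and> K \<le> j then offdiag A i j else 0)"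
  by (simp add: offdiag_def strip_def)

text \<open>Averaging over the sign of observation \<open>K\<close> removes its interaction with all other observations.\<close>

lemma qpart_strip_Suc:
  "qpart (strip (Suc K) A) y N = (qpart (strip K A) y N + qpart (strip K A) (\<lambda>i. flip K i * y i) N) / 2"
proof -
  have "strip (Suc K) A i j * y i * y j
      = (strip K A i j * y i * y j + strip K A i j * (flip K i * y i) * (flip K j * y j)) / 2" for i j
    by (cases "i = K"; cases "j = K") (auto simp: strip_def flip_def not_less_eq_eq le_Suc_eq)
  then have "qpart (strip (Suc K) A) y N
      = (\<Sum>i<N. \<Sum>j<N. (strip K A i j * y i * y j + strip K A i j * (flip K i * y i) * (flip K j * y j)) / 2)"
    unfolding qpart_def by (simp only:)
  also have "\<dots> = (qpart (strip K A) y N + qpart (strip K A) (\<lambda>i. flip K i * y i) N) / 2"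
    unfolding qpart_def sum_divide_distrib[symmetric] sum.distrib ..
  finally show ?thesis .
qed

section \<open>Coefficients of forms whose risk is bounded under all sign changes\<close>

locale signal =
  fixes \<theta> :: seq and s :: real
  assumes summable_signal: "summable (\<lambda>i. (\<theta> i)\<^sup>2)" and s_pos: "s > 0"
begin

definition Y :: "seq \<Rightarrow> seq" where
  "Y z i = \<theta> i + s * z i"

lemma measurable_Y [measurable]: "(\<lambda>z. Y z i) \<in> borel_measurable gauss_noise"
  unfolding Y_def by measurable

text \<open>By symmetry of the noise, \<open>e i * Y z i\<close> has the law of the observation of the signal \<open>e i * \<theta> i\<close>, so with
  \<open>k = c - Qf \<theta>\<close> this says that the risk is at most \<open>M\<close> at every sign change of the signal.\<close>

definition controlled :: "(nat \<Rightarrow> nat \<Rightarrow> real) \<Rightarrow> real \<Rightarrow> real \<Rightarrow> bool" where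
  "controlled A k M \<longleftrightarrow> (\<forall>e. signs e \<longrightarrow>
     (AE z in gauss_noise. convergent (qpart A (\<lambda>i. e i * Y z i))) \<and>
     (\<lambda>z. lim (qpart A (\<lambda>i. e i * Y z i)) + k) \<in> L2 \<and>
     (\<integral>z. (lim (qpart A (\<lambda>i. e i * Y z i)) + k)\<^sup>2 \<partial>gauss_noise) \<le> M)"

text \<open>Two-point Jensen. The average for the pattern \<open>e\<close> involves \<open>e\<close>
  and the pattern differing from it at \<open>K\<close>; both are covered because
  \<open>controlled\<close> quantifies over all patterns, so the bound \<open>M\<close> is
  reproduced.\<close>

lemma controlled_strip_Suc:
  assumes c: "controlled (strip K A) k M"
  shows "controlled (strip (Suc K) A) k M"
  unfolding controlled_def
proof (intro allI impI conjI)
  fix e assume e: "signs e"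
  define e' where "e' i = e i * flip K i" for i
  have e': "signs e'" using e signs_flip[of K] by (auto simp: signs_def e'_def flip_def)
  let ?u = "\<lambda>e z. lim (qpart (strip K A) (\<lambda>i. e i * Y z i)) + k"
  let ?w = "\<lambda>z. lim (qpart (strip (Suc K) A) (\<lambda>i. e i * Y z i)) + k"
  have avg: "qpart (strip (Suc K) A) (\<lambda>i. e i * Y z i)
      = (\<lambda>N. (qpart (strip K A) (\<lambda>i. e i * Y z i) N + qpart (strip K A) (\<lambda>i. e' i * Y z i) N) / 2)" for z
    by (simp add: fun_eq_iff qpart_strip_Suc e'_def mult_ac)
  have conv: "AE z in gauss_noise. convergent (qpart (strip K A) (\<lambda>i. e i * Y z i))"
      "AE z in gauss_noise. convergent (qpart (strip K A) (\<lambda>i. e' i * Y z i))"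
    and L: "?u e \<in> L2" "?u e' \<in> L2"
    and M: "(\<integral>z. (?u e z)\<^sup>2 \<partial>gauss_noise) \<le> M" "(\<integral>z. (?u e' z)\<^sup>2 \<partial>gauss_noise) \<le> M"
    using c e e' by (auto simp: controlled_def)
  have lim: "AE z in gauss_noise. convergent (qpart (strip (Suc K) A) (\<lambda>i. e i * Y z i)) \<and> (?u e z + ?u e' z) / 2 = ?w z"
    using conv
  proof eventually_elim
    case (elim z)
    then have "(\<lambda>N. (qpart (strip K A) (\<lambda>i. e i * Y z i) N + qpart (strip K A) (\<lambda>i. e' i * Y z i) N) / 2)
        \<longlonglongrightarrow> (lim (qpart (strip K A) (\<lambda>i. e i * Y z i)) + lim (qpart (strip K A) (\<lambda>i. e' i * Y z i))) / 2"
      by (intro tendsto_divide tendsto_add tendsto_const) (auto simp: convergent_LIMSEQ_iff)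
    then show ?case unfolding avg by (auto simp: convergent_def limI add_divide_distrib)
  qed
  then show "AE z in gauss_noise. convergent (qpart (strip (Suc K) A) (\<lambda>i. e i * Y z i))" by auto
  have lim': "AE z in gauss_noise. (?u e z + ?u e' z) / 2 = ?w z"
    using lim by eventually_elim blast
  have half: "(\<lambda>z. (?u e z + ?u e' z) / 2) \<in> L2"
    using L2_scale[OF L2_add[OF L], of "1/2"] by simp
  show w: "?w \<in> L2"
    by (rule L2_cong_AE[OF half _ lim']) measurable
  have "(\<integral>z. (?w z)\<^sup>2 \<partial>gauss_noise) = (\<integral>z. ((?u e z + ?u e' z) / 2)\<^sup>2 \<partial>gauss_noise)"
  proof (rule integral_cong_AE)
    show "AE z in gauss_noise. (?w z)\<^sup>2 = ((?u e z + ?u e' z) / 2)\<^sup>2"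
      using lim' by eventually_elim (simp only:)
  qed measurable
  also have "\<dots> \<le> (\<integral>z. (?u e z)\<^sup>2 / 2 + (?u e' z)\<^sup>2 / 2 \<partial>gauss_noise)"
  proof (rule integral_mono[OF L2_integrable_square[OF half]])
    have "((x + y) / 2)\<^sup>2 \<le> x\<^sup>2 / 2 + y\<^sup>2 / 2" for x y :: real
      using zero_le_power2[of "x - y"] by (simp add: power2_eq_square field_simps)
    then show "((?u e z + ?u e' z) / 2)\<^sup>2 \<le> (?u e z)\<^sup>2 / 2 + (?u e' z)\<^sup>2 / 2" for z .
  qed (use L in \<open>simp add: L2_integrable_square\<close>)
  also have "\<dots> \<le> M" using M L by (simp add: L2_integrable_square)
  finally show "(\<integral>z. (?w z)\<^sup>2 \<partial>gauss_noise) \<le> M" .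
qed

lemma controlled_strip: "controlled A k M \<Longrightarrow> controlled (strip K A) k M"
  by (induction K) (auto intro: controlled_strip_Suc)

lemma
  assumes "controlled A k M"
  shows controlled_convergent: "AE z in gauss_noise. convergent (qpart A (Y z))"
    and controlled_L2: "(\<lambda>z. lim (qpart A (Y z)) + k) \<in> L2"
    and controlled_le: "(\<integral>z. (lim (qpart A (Y z)) + k)\<^sup>2 \<partial>gauss_noise) \<le> M"
  using assms[unfolded controlled_def, rule_format, of "\<lambda>_. 1"] by (auto simp: signs_def)

text \<open>The mixed second difference in the signs of \<open>z i\<close> and \<open>z j\<close>
  keeps exactly the part that is odd in both, four times. The result no longer depends on
  \<open>N\<close>, so it survives any limit.\<close>

lemma qpart_second_difference:
  assumes ij: "i < j" and N: "j < N"
  shows "qpart A (Y z) N - qpart A (Y (\<lambda>m. flip i m * z m)) N - qpart A (Y (\<lambda>m. flip j m * z m)) N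
      + qpart A (Y (\<lambda>m. flip i m * flip j m * z m)) N = 4 * (s\<^sup>2 * offdiag A i j * (z i * z j))"
proof -
  define c where "c = 4 * s\<^sup>2 * (z i * z j)"
  have *: "A a b * Y z a * Y z b - A a b * Y (\<lambda>m. flip i m * z m) a * Y (\<lambda>m. flip i m * z m) b
      - A a b * Y (\<lambda>m. flip j m * z m) a * Y (\<lambda>m. flip j m * z m) b
      + A a b * Y (\<lambda>m. flip i m * flip j m * z m) a * Y (\<lambda>m. flip i m * flip j m * z m) b
     = (if a = i then if b = j then A a b * c else 0 else 0) + (if a = j then if b = i then A a b * c else 0 else 0)" for a b
    using ij by (cases "a = i"; cases "a = j"; cases "b = i"; cases "b = j")
      (simp_all add: Y_def flip_def c_def algebra_simps power2_eq_square)
  have "qpart A (Y z) N - qpart A (Y (\<lambda>m. flip i m * z m)) N - qpart A (Y (\<lambda>m. flip j m * z m)) N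
      + qpart A (Y (\<lambda>m. flip i m * flip j m * z m)) N
      = (\<Sum>a<N. \<Sum>b<N. (if a = i then if b = j then A a b * c else 0 else 0) + (if a = j then if b = i then A a b * c else 0 else 0))"
    unfolding qpart_def sum_subtractf[symmetric] sum.distrib[symmetric] * ..
  also have "\<dots> = (\<Sum>a<N. if a = i then \<Sum>b<N. if b = j then A a b * c else 0 else 0)
      + (\<Sum>a<N. if a = j then \<Sum>b<N. if b = i then A a b * c else 0 else 0)"
    unfolding sum.distrib by (intro arg_cong2[where f = "(+)"] sum.cong refl) auto
  also have "\<dots> = A i j * c + A j i * c" using ij N by simp
  finally show ?thesis using ij by (simp add: c_def offdiag_def algebra_simps)
qed

lemma controlled_coefficient:
  assumes c: "controlled A k M" and ij: "i < j"
  shows "(\<integral>z. (lim (qpart A (Y z)) + k) * (z i * z j) \<partial>gauss_noise) = s\<^sup>2 * offdiag A i j"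
proof -
  define u where "u z = lim (qpart A (Y z)) + k" for z
  have u: "u \<in> L2" unfolding u_def[abs_def] by (rule controlled_L2[OF c])
  have [measurable]: "u \<in> borel_measurable gauss_noise" using u by simp
  define h where "h z = z i * z j" for z :: seq
  have h: "h \<in> L2" unfolding h_def[abs_def] by simp
  have [measurable]: "h \<in> borel_measurable gauss_noise" using h by simp
  have fl: "signs (\<lambda>m. flip i m * flip j m)" by (auto simp: signs_def flip_def)
  let ?u1 = "\<lambda>z. u (\<lambda>m. flip i m * z m)" and ?u2 = "\<lambda>z. u (\<lambda>m. flip j m * z m)"
    and ?u3 = "\<lambda>z. u (\<lambda>m. flip i m * flip j m * z m)"
  have conv: "AE z in gauss_noise. convergent (qpart A (Y z))" by (rule controlled_convergent[OF c])
  have "AE z in gauss_noise. u z - ?u1 z - ?u2 z + ?u3 z = 4 * (s\<^sup>2 * offdiag A i j * h z)"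
    using conv AE_gauss_signs[OF signs_flip[of i] conv] AE_gauss_signs[OF signs_flip[of j] conv] AE_gauss_signs[OF fl conv]
  proof eventually_elim
    case (elim z)
    have "(\<lambda>N. qpart A (Y z) N - qpart A (Y (\<lambda>m. flip i m * z m)) N - qpart A (Y (\<lambda>m. flip j m * z m)) N
      + qpart A (Y (\<lambda>m. flip i m * flip j m * z m)) N)
      \<longlonglongrightarrow> lim (qpart A (Y z)) - lim (qpart A (Y (\<lambda>m. flip i m * z m))) - lim (qpart A (Y (\<lambda>m. flip j m * z m)))
      + lim (qpart A (Y (\<lambda>m. flip i m * flip j m * z m)))"
      by (intro tendsto_add tendsto_diff) (use elim in \<open>simp_all add: convergent_LIMSEQ_iff\<close>)
    moreover have "\<forall>\<^sub>F N in sequentially. qpart A (Y z) N - qpart A (Y (\<lambda>m. flip i m * z m)) N - qpart A (Y (\<lambda>m. flip j m * z m)) N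
      + qpart A (Y (\<lambda>m. flip i m * flip j m * z m)) N = 4 * (s\<^sup>2 * offdiag A i j * h z)"
      using eventually_gt_at_top[of j] by eventually_elim (simp add: qpart_second_difference[OF ij] h_def)
    ultimately have "(\<lambda>N::nat. 4 * (s\<^sup>2 * offdiag A i j * h z))
      \<longlonglongrightarrow> lim (qpart A (Y z)) - lim (qpart A (Y (\<lambda>m. flip i m * z m))) - lim (qpart A (Y (\<lambda>m. flip j m * z m)))
      + lim (qpart A (Y (\<lambda>m. flip i m * flip j m * z m)))"
      by (rule Lim_transform_eventually)
    then show ?case by (simp add: LIMSEQ_const_iff u_def)
  qed
  then have "(\<integral>z. (u z - ?u1 z - ?u2 z + ?u3 z) * h z \<partial>gauss_noise) = (\<integral>z. 4 * (s\<^sup>2 * offdiag A i j * h z) * h z \<partial>gauss_noise)"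
    by (intro integral_cong_AE) (auto intro!: borel_measurable_times borel_measurable_add borel_measurable_diff L2_measurable L2_signs u fl)
  also have "\<dots> = (\<integral>z. 4 * s\<^sup>2 * offdiag A i j * (z i * z j)\<^sup>2 \<partial>gauss_noise)"
    by (simp add: h_def power2_eq_square mult_ac)
  also have "\<dots> = 4 * s\<^sup>2 * offdiag A i j"
    using ij by (simp add: integral_coordinate_mult_square)
  also have "(\<integral>z. (u z - ?u1 z - ?u2 z + ?u3 z) * h z \<partial>gauss_noise)
     = (\<integral>z. u z * h z - ?u1 z * h z - ?u2 z * h z + ?u3 z * h z \<partial>gauss_noise)"
    by (simp add: algebra_simps)
  also have "\<dots> = (\<integral>z. u z * h z \<partial>gauss_noise) - (\<integral>z. ?u1 z * h z \<partial>gauss_noise)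
      - (\<integral>z. ?u2 z * h z \<partial>gauss_noise) + (\<integral>z. ?u3 z * h z \<partial>gauss_noise)"
    using L2_mult_integrable[OF u h] L2_mult_integrable[OF L2_signs[OF signs_flip[of i] u] h]
      L2_mult_integrable[OF L2_signs[OF signs_flip[of j] u] h] L2_mult_integrable[OF L2_signs[OF fl u] h]
    by simp
  also have "(\<integral>z. ?u1 z * h z \<partial>gauss_noise) = - (\<integral>z. u z * h z \<partial>gauss_noise)"
    using integral_gauss_signs[OF signs_flip[of i], of "\<lambda>z. u z * h z"] ij by (simp add: h_def flip_def)
  also have "(\<integral>z. ?u2 z * h z \<partial>gauss_noise) = - (\<integral>z. u z * h z \<partial>gauss_noise)"
    using integral_gauss_signs[OF signs_flip[of j], of "\<lambda>z. u z * h z"] ij by (simp add: h_def flip_def)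
  also have "(\<integral>z. ?u3 z * h z \<partial>gauss_noise) = (\<integral>z. u z * h z \<partial>gauss_noise)"
    using integral_gauss_signs[OF fl, of "\<lambda>z. u z * h z"] ij by (simp add: h_def flip_def)
  finally show ?thesis by (simp add: u_def h_def)
qed

lemma controlled_offdiag_bounded:
  assumes c: "controlled A k M"
  shows "(\<Sum>i<N. \<Sum>j<N. (offdiag A i j)\<^sup>2) \<le> M / s ^ 4"
proof -
  let ?I = "{p\<in>{..<N}\<times>{..<N}. fst p < snd p}"
  have "(\<Sum>p\<in>?I. (\<integral>z. (lim (qpart A (Y z)) + k) * (z (fst p) * z (snd p)) \<partial>gauss_noise)\<^sup>2)
      \<le> (\<integral>z. (lim (qpart A (Y z)) + k)\<^sup>2 \<partial>gauss_noise)"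
    by (rule Bessel_inequality)
      (use controlled_L2[OF c] in \<open>auto simp: integral_coordinate_mult_square intro!: integral_pair_orthogonal\<close>)
  also have "\<dots> \<le> M" by (rule controlled_le[OF c])
  also have "(\<Sum>p\<in>?I. (\<integral>z. (lim (qpart A (Y z)) + k) * (z (fst p) * z (snd p)) \<partial>gauss_noise)\<^sup>2)
      = (\<Sum>p\<in>?I. s ^ 4 * (offdiag A (fst p) (snd p))\<^sup>2)"
    by (intro sum.cong refl) (auto simp: controlled_coefficient[OF c] power_mult_distrib)
  also have "\<dots> = s ^ 4 * (\<Sum>p\<in>{..<N}\<times>{..<N}. (offdiag A (fst p) (snd p))\<^sup>2)"
    unfolding sum_distrib_left[symmetric] by (intro arg_cong2[where f = "(*)"] sum.mono_neutral_left) (auto simp: offdiag_def)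
  finally show ?thesis
    using s_pos by (simp add: field_simps sum.cartesian_product case_prod_beta)
qed

end

text \<open>An increment between square partial sums becomes a single form whose coefficients vanish
  on the inner square, so estimates for forms apply to increments.\<close>

lemma sum_masked:
  fixes f :: "nat \<Rightarrow> nat \<Rightarrow> real"
  assumes "M \<le> N"
  shows "(\<Sum>i<N. \<Sum>j<N. if i < M \<and> j < M then 0 else f i j) = (\<Sum>i<N. \<Sum>j<N. f i j) - (\<Sum>i<M. \<Sum>j<M. f i j)"
proof -
  have "(\<Sum>(i, j)\<in>{..<N}\<times>{..<N}. if i < M \<and> j < M then 0 else f i j) = (\<Sum>(i, j)\<in>{..<N}\<times>{..<N} - {..<M}\<times>{..<M}. f i j)"
    by (rule sum.mono_neutral_cong_right) (auto split: if_splits)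
  also have "\<dots> = (\<Sum>(i, j)\<in>{..<N}\<times>{..<N}. f i j) - (\<Sum>(i, j)\<in>{..<M}\<times>{..<M}. f i j)"
    using assms by (intro sum_diff) auto
  finally show ?thesis unfolding sum.cartesian_product .
qed

section \<open>Diagonal and off-diagonal parts at a fixed signal\<close>

context signal
begin

lemma L2_Y: "(\<lambda>z. Y z i * Y z j) \<in> L2"
proof -
  have "(\<lambda>z. \<theta> i * \<theta> j + (s * \<theta> i) * z j + (s * \<theta> j) * z i + s\<^sup>2 * (z i * z j)) \<in> L2"
    by (intro L2_add L2_scale) auto
  then show ?thesis by (simp add: Y_def algebra_simps power2_eq_square)
qed

text \<open>With \<open>x\<close> the noise coordinate, this is \<open>a i\<close> times the squared
  observation minus its mean, the latter being the squared signal plus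
  \<open>s\<^sup>2\<close>.\<close>

definition centered_square :: "(nat \<Rightarrow> real) \<Rightarrow> nat \<Rightarrow> real \<Rightarrow> real" where
  "centered_square a i x = a i * ((\<theta> i + s * x)\<^sup>2 - (\<theta> i)\<^sup>2 - s\<^sup>2)"

lemma centered_square_expand: "centered_square a i x = a i * (2 * s * \<theta> i) * x + (a i * s\<^sup>2) * (x * x) + - (a i * s\<^sup>2)"
  by (simp add: centered_square_def power2_eq_square algebra_simps)

lemma centered_centered_square: "centered (centered_square a)"
proof
  fix i
  show "centered_square a i \<in> borel_measurable borel" unfolding centered_square_def[abs_def] by measurable
  show "(\<lambda>z. centered_square a i (z i)) \<in> L2" unfolding centered_square_expand by (intro L2_add L2_scale) auto
  show "(\<integral>z. centered_square a i (z i) \<partial>gauss_noise) = 0"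
    unfolding centered_square_expand by (simp add: gauss_moments power2_eq_square[symmetric])
qed

sublocale centered "centered_square a" for a by (rule centered_centered_square)

text \<open>Expand and insert the Gaussian moments 0, 1, 0, 3. The value is affine in the squared
  signal, which makes the variance linear under mixing in the quadratic hull.\<close>

lemma var_centered_square: "var a i = (a i)\<^sup>2 * (2 * s ^ 4 + 4 * s\<^sup>2 * (\<theta> i)\<^sup>2)"
proof -
  have "(centered_square a i x)\<^sup>2 = (a i)\<^sup>2 * (4 * s\<^sup>2 * (\<theta> i)\<^sup>2 - 2 * s ^ 4) * x ^ 2 + (a i)\<^sup>2 * (4 * \<theta> i * s ^ 3) * x ^ 3
     + - ((a i)\<^sup>2 * (4 * \<theta> i * s ^ 3)) * x + (a i)\<^sup>2 * s ^ 4 * x ^ 4 + (a i)\<^sup>2 * s ^ 4" for x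
    unfolding centered_square_def by (simp add: power2_eq_square power3_eq_cube power4_eq_xxxx algebra_simps)
  then have "var a i = (\<integral>z. (a i)\<^sup>2 * (4 * s\<^sup>2 * (\<theta> i)\<^sup>2 - 2 * s ^ 4) * z i ^ 2 + (a i)\<^sup>2 * (4 * \<theta> i * s ^ 3) * z i ^ 3
     + - ((a i)\<^sup>2 * (4 * \<theta> i * s ^ 3)) * z i + (a i)\<^sup>2 * s ^ 4 * z i ^ 4 + (a i)\<^sup>2 * s ^ 4 \<partial>gauss_noise)"
    unfolding var_def by simp
  also have "\<dots> = (a i)\<^sup>2 * (4 * s\<^sup>2 * (\<theta> i)\<^sup>2 - 2 * s ^ 4) + (a i)\<^sup>2 * s ^ 4 * 3 + (a i)\<^sup>2 * s ^ 4"
    by (simp add: gauss_moments)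
  finally show ?thesis by (simp add: algebra_simps)
qed

definition diag_mean :: "(nat \<Rightarrow> real) \<Rightarrow> nat \<Rightarrow> real" where
  "diag_mean a N = (\<Sum>i<N. a i * ((\<theta> i)\<^sup>2 + s\<^sup>2))"

lemma diag_part: "(\<Sum>i<N. a i * (Y z i)\<^sup>2) = (\<Sum>i<N. centered_square a i (z i)) + diag_mean a N"
  unfolding diag_mean_def sum.distrib[symmetric] by (intro sum.cong) (auto simp: centered_square_def Y_def algebra_simps)

lemma summable_weighted_signal:
  assumes "summable (\<lambda>i. (a i)\<^sup>2)"
  shows "summable (\<lambda>i. a i * (\<theta> i)\<^sup>2)" "summable (\<lambda>i. (a i)\<^sup>2 * (\<theta> i)\<^sup>2)"
proof -
  have "Bseq (\<lambda>i. (a i)\<^sup>2)"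
    using assms by (intro convergent_imp_Bseq) (auto simp: convergent_def dest: summable_LIMSEQ_zero)
  then obtain B where B: "(a i)\<^sup>2 \<le> B" for i by (auto simp: Bseq_def)
  \<comment> \<open>This rests on 2|a| <= a^2 + 1, which bounds \<open>a i\<close> without taking a
    square root of \<open>B\<close>.\<close>
  have "\<bar>a i\<bar> \<le> 1 + B" for i
    using B[of i] sum_squares_bound[of "\<bar>a i\<bar>" 1] by simp
  then show "summable (\<lambda>i. a i * (\<theta> i)\<^sup>2)"
    by (intro summable_comparison_test'[OF summable_mult[OF summable_signal, of "1 + B"], of 0])
      (auto simp: abs_mult intro!: mult_right_mono)
  show "summable (\<lambda>i. (a i)\<^sup>2 * (\<theta> i)\<^sup>2)"
    by (intro summable_comparison_test'[OF summable_mult[OF summable_signal, of B], of 0])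
      (auto simp: abs_mult intro!: mult_right_mono B)
qed

lemma summable_var: 
  assumes "summable (\<lambda>i. (a i)\<^sup>2)"
  shows "summable (var a)"
proof -
  have "var a = (\<lambda>i. 2 * s ^ 4 * (a i)\<^sup>2 + 4 * s\<^sup>2 * ((a i)\<^sup>2 * (\<theta> i)\<^sup>2))"
    by (simp add: fun_eq_iff var_centered_square algebra_simps)
  then show ?thesis
    using assms summable_weighted_signal(2)[OF assms] by (auto intro!: summable_add summable_mult)
qed

definition centered_limit :: "(nat \<Rightarrow> real) \<Rightarrow> seq \<Rightarrow> real" where
  "centered_limit a z = lim (\<lambda>N. \<Sum>i<N. centered_square a i (z i))"

lemma centered_limit:
  assumes "summable (\<lambda>i. (a i)\<^sup>2)"
  shows "AE z in gauss_noise. (\<lambda>N. \<Sum>i<N. centered_square a i (z i)) \<longlonglongrightarrow> centered_limit a z"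
    and "centered_limit a \<in> L2"
    and "(\<integral>z. (centered_limit a z + m)\<^sup>2 \<partial>gauss_noise) = (\<Sum>i. var a i) + m\<^sup>2"
proof -
  have [measurable]: "centered_limit a \<in> borel_measurable gauss_noise"
    unfolding centered_limit_def[abs_def] by measurable
  show lim: "AE z in gauss_noise. (\<lambda>N. \<Sum>i<N. centered_square a i (z i)) \<longlonglongrightarrow> centered_limit a z"
    using AE_convergent[OF summable_var[OF assms]] by (simp add: centered_limit_def convergent_LIMSEQ_iff)
  show L: "centered_limit a \<in> L2" by (rule L2_limit[OF summable_var[OF assms] _ lim]) simp
  have "(\<integral>z. centered_limit a z \<partial>gauss_noise) = 0" "(\<integral>z. (centered_limit a z)\<^sup>2 \<partial>gauss_noise) = (\<Sum>i. var a i)"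
    by (rule integral_limit[OF summable_var[OF assms] _ lim] integral_square_limit[OF summable_var[OF assms] _ lim]; simp)+
  then show "(\<integral>z. (centered_limit a z + m)\<^sup>2 \<partial>gauss_noise) = (\<Sum>i. var a i) + m\<^sup>2"
    using integral_square_add[OF L L2_const[of m]] by simp
qed

definition offdiag_part :: "(nat \<Rightarrow> nat \<Rightarrow> real) \<Rightarrow> nat \<Rightarrow> seq \<Rightarrow> real" where
  "offdiag_part A N z = (\<Sum>i<N. \<Sum>j<N. offdiag A i j * (Y z i * Y z j))"

lemma L2_offdiag_part: "offdiag_part A N \<in> L2"
  unfolding offdiag_part_def[abs_def] by (intro L2_sum L2_scale L2_Y)

lemma qpart_Y: "qpart A (Y z) N = (\<Sum>i<N. centered_square (\<lambda>i. A i i) i (z i)) + diag_mean (\<lambda>i. A i i) N + offdiag_part A N z"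
  unfolding qpart_split diag_part offdiag_part_def ..

text \<open>The squared Hilbert-Schmidt norm of the leading block of size \<open>N\<close>. Its
  increments measure the off-diagonal tail.\<close>

definition offdiag_norm :: "(nat \<Rightarrow> nat \<Rightarrow> real) \<Rightarrow> nat \<Rightarrow> real" where
  "offdiag_norm A N = (\<Sum>i<N. \<Sum>j<N. (offdiag A i j)\<^sup>2)"

lemma offdiag_norm_masked:
  assumes "M \<le> N"
  shows "(\<Sum>i<N. \<Sum>j<N. (if i < M \<and> j < M then 0 else offdiag A i j)\<^sup>2) = offdiag_norm A N - offdiag_norm A M"
  unfolding offdiag_norm_def sum_masked[OF assms, symmetric] by (intro sum.cong refl) simp

lemma offdiag_norm_mono: "M \<le> N \<Longrightarrow> offdiag_norm A M \<le> offdiag_norm A N"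
  using offdiag_norm_masked[of M N A] by (smt (verit) sum_nonneg zero_le_power2)

lemma offdiag_part_masked:
  assumes "M \<le> N"
  shows "(\<Sum>i<N. \<Sum>j<N. (if i < M \<and> j < M then 0 else offdiag A i j) * (Y z i * Y z j)) = offdiag_part A N z - offdiag_part A M z"
  unfolding offdiag_part_def sum_masked[OF assms, symmetric] by (intro sum.cong refl) simp

lemma offdiag_part_increment:
  assumes "M \<le> N"
  shows "(\<integral>z. (offdiag_part A N z - offdiag_part A M z)\<^sup>2 \<partial>gauss_noise) \<le> 4 * (Qf \<theta> + s\<^sup>2)\<^sup>2 * (offdiag_norm A N - offdiag_norm A M)"
  using integral_square_offdiagonal(2)[where b = "\<lambda>i j. if i < M \<and> j < M then 0 else offdiag A i j" and \<theta> = \<theta> and N = N and s = s] summable_signal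
  unfolding Y_def[symmetric] offdiag_part_masked[OF assms] offdiag_norm_masked[OF assms] by (simp add: offdiag_def)

text \<open>Stripping removes at least the inner square of size \<open>K\<close>, so what remains is
  at most an increment of \<open>offdiag_norm\<close> beyond \<open>K\<close>. Once that sequence
  converges, this is small for large \<open>K\<close>, uniformly in \<open>N\<close>; the maximum
  covers \<open>N\<close> below \<open>K\<close>.\<close>

lemma offdiag_part_strip_le:
  "(\<integral>z. (offdiag_part (strip K A) N z)\<^sup>2 \<partial>gauss_noise) \<le> 4 * (Qf \<theta> + s\<^sup>2)\<^sup>2 * (offdiag_norm A (max K N) - offdiag_norm A K)"
proof -
  have "offdiag_norm (strip K A) N \<le> (\<Sum>i<N. \<Sum>j<N. (if i < K \<and> j < K then 0 else offdiag A i j)\<^sup>2)"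
    unfolding offdiag_norm_def by (intro sum_mono) (simp add: offdiag_strip)
  also have "\<dots> \<le> (\<Sum>i<max K N. \<Sum>j<max K N. (if i < K \<and> j < K then 0 else offdiag A i j)\<^sup>2)"
    unfolding sum.cartesian_product by (intro sum_mono2) auto
  also have "\<dots> = offdiag_norm A (max K N) - offdiag_norm A K" by (rule offdiag_norm_masked) simp
  finally have "offdiag_norm (strip K A) N \<le> offdiag_norm A (max K N) - offdiag_norm A K" .
  moreover have "(\<integral>z. (offdiag_part (strip K A) N z)\<^sup>2 \<partial>gauss_noise) \<le> 4 * (Qf \<theta> + s\<^sup>2)\<^sup>2 * offdiag_norm (strip K A) N"
    using offdiag_part_increment[of 0 N "strip K A"] by (simp add: offdiag_part_def offdiag_norm_def)
  ultimately show ?thesis by (smt (verit) mult_left_mono zero_le_power2)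
qed

lemma controlled_offdiag_norm_convergent: "controlled A k M \<Longrightarrow> convergent (offdiag_norm A)"
  by (rule Bseq_mono_convergent[OF BseqI'[of _ "M / s ^ 4"]])
    (use controlled_offdiag_bounded[of A k M] in \<open>auto simp: offdiag_norm_def[symmetric] offdiag_norm_mono\<close>, auto simp: offdiag_norm_def sum_nonneg)

lemma qpart_strip_split:
  assumes "K \<le> N"
  shows "qpart (strip K A) (Y z) N = (\<Sum>i<K. centered_square (\<lambda>i. A i i) i (z i)) + diag_mean (\<lambda>i. A i i) K
    + (\<Sum>i\<in>{K..<N}. \<Sum>j\<in>{K..<N}. A i j * Y z i * Y z j)"
proof -
  have "qpart (strip K A) (Y z) N = (\<Sum>i<N. (if i < K then A i i * (Y z i)\<^sup>2 else 0)
     + (if K \<le> i then \<Sum>j<N. if K \<le> j then A i j * Y z i * Y z j else 0 else 0))"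
    unfolding qpart_def
  proof (intro sum.cong refl)
    fix i assume "i \<in> {..<N}"
    then show "(\<Sum>j<N. strip K A i j * Y z i * Y z j) = (if i < K then A i i * (Y z i)\<^sup>2 else 0)
     + (if K \<le> i then \<Sum>j<N. if K \<le> j then A i j * Y z i * Y z j else 0 else 0)"
    proof (cases "i < K")
      case True
      then have "(\<Sum>j<N. strip K A i j * Y z i * Y z j) = (\<Sum>j<N. if j = i then A i i * (Y z i)\<^sup>2 else 0)"
        by (intro sum.cong refl) (auto simp: strip_def power2_eq_square)
      with True \<open>i \<in> {..<N}\<close> show ?thesis by simp
    qed (auto simp: strip_def intro!: sum.cong)
  qed
  also have "\<dots> = (\<Sum>i<K. A i i * (Y z i)\<^sup>2) + (\<Sum>i\<in>{K..<N}. \<Sum>j\<in>{K..<N}. A i j * Y z i * Y z j)"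
    unfolding sum.distrib using assms
    by (intro arg_cong2[where f = "(+)"] sum.mono_neutral_cong_right) (auto intro!: sum.mono_neutral_cong_right)
  finally show ?thesis unfolding diag_part .
qed

text \<open>In the stripped form the first \<open>K\<close> observations enter only through their squares, independently of the rest.\<close>

lemma controlled_diag_bounded:
  assumes c: "controlled A k M"
  shows "(\<Sum>i<K. var (\<lambda>i. A i i) i) \<le> M"
proof -
  define x where "x z = (\<Sum>i<K. centered_square (\<lambda>i. A i i) i (z i))" for z :: seq
  define u where "u z = lim (qpart (strip K A) (Y z)) + k" for z
  \<comment> \<open>Defined through the tail sums rather than as \<open>u z - x z\<close>, so that
    it depends on the coordinates from \<open>K\<close> on at every point and not merely almost
    everywhere.\<close>
  define t where "t z = lim (\<lambda>N. \<Sum>i\<in>{K..<N}. \<Sum>j\<in>{K..<N}. A i j * Y z i * Y z j) + (diag_mean (\<lambda>i. A i i) K + k)" for z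
  have [measurable]: "t \<in> borel_measurable gauss_noise" unfolding t_def[abs_def] by measurable
  note cs = controlled_strip[OF c, of K]
  have u: "u \<in> L2" and uM: "(\<integral>z. (u z)\<^sup>2 \<partial>gauss_noise) \<le> M"
    using controlled_L2[OF cs] controlled_le[OF cs] by (simp_all add: u_def[abs_def])
  have x: "x \<in> L2" unfolding x_def[abs_def] by (intro L2_sum in_L2)
  have x0: "(\<integral>z. x z \<partial>gauss_noise) = 0"
    unfolding x_def by (subst Bochner_Integration.integral_sum) (auto simp: mean intro: L2_integrable in_L2)
  have ae: "AE z in gauss_noise. u z - x z = t z"
    using controlled_convergent[OF cs]
  proof eventually_elim
    case (elim z)
    then have "(\<lambda>N. qpart (strip K A) (Y z) N - x z - diag_mean (\<lambda>i. A i i) K) \<longlonglongrightarrow> lim (qpart (strip K A) (Y z)) - x z - diag_mean (\<lambda>i. A i i) K"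
      by (intro tendsto_diff tendsto_const) (simp add: convergent_LIMSEQ_iff)
    moreover have "\<forall>\<^sub>F N in sequentially. qpart (strip K A) (Y z) N - x z - diag_mean (\<lambda>i. A i i) K
        = (\<Sum>i\<in>{K..<N}. \<Sum>j\<in>{K..<N}. A i j * Y z i * Y z j)"
      using eventually_ge_at_top[of K] by eventually_elim (simp add: qpart_strip_split x_def)
    ultimately have "(\<lambda>N. \<Sum>i\<in>{K..<N}. \<Sum>j\<in>{K..<N}. A i j * Y z i * Y z j)
        \<longlonglongrightarrow> lim (qpart (strip K A) (Y z)) - x z - diag_mean (\<lambda>i. A i i) K"
      by (rule Lim_transform_eventually)
    from limI[OF this] show ?case by (simp add: t_def u_def)
  qed
  have t: "t \<in> L2" by (rule L2_cong_AE[OF L2_diff[OF u x] _ ae]) simp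
  have "(\<integral>z. x z * t z \<partial>gauss_noise) = (\<integral>z. x z \<partial>gauss_noise) * (\<integral>z. t z \<partial>gauss_noise)"
  proof (rule integral_mult_depends_on[of "{..<K}" _ "{K..}"])
    show "depends_on {..<K} x" by (auto simp: depends_on_def x_def)
    show "depends_on {K..} t"
      unfolding depends_on_def t_def Y_def
      by (intro allI impI arg_cong2[where f = "(+)"] arg_cong[where f = lim] ext sum.cong) auto
  qed (use x t in \<open>auto intro: L2_integrable\<close>)
  then have "(\<integral>z. (x z + t z)\<^sup>2 \<partial>gauss_noise) = (\<integral>z. (x z)\<^sup>2 \<partial>gauss_noise) + (\<integral>z. (t z)\<^sup>2 \<partial>gauss_noise)"
    using integral_square_add[OF x t] x0 by simp
  also have "(\<integral>z. (x z + t z)\<^sup>2 \<partial>gauss_noise) = (\<integral>z. (u z)\<^sup>2 \<partial>gauss_noise)"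
  proof (rule integral_cong_AE)
    show "AE z in gauss_noise. (x z + t z)\<^sup>2 = (u z)\<^sup>2"
      using ae by eventually_elim (auto simp: algebra_simps)
  qed (use x t u in measurable)
  also have "(\<integral>z. (x z)\<^sup>2 \<partial>gauss_noise) = (\<Sum>i<K. var (\<lambda>i. A i i) i)"
    unfolding x_def by (rule integral_square_sum) simp
  finally show ?thesis using uM by (smt (verit) integral_nonneg_AE AE_I2 zero_le_power2)
qed

lemma controlled_diag_summable:
  assumes c: "controlled A k M"
  shows "summable (\<lambda>i. (A i i)\<^sup>2)"
proof (rule summable_comparison_test')
  have "summable (var (\<lambda>i. A i i))"
    by (rule summableI_nonneg_bounded[of _ M]) (auto intro: controlled_diag_bounded[OF c])
  then show "summable (\<lambda>i. var (\<lambda>i. A i i) i / (2 * s ^ 4))" by (rule summable_divide)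
  \<comment> \<open>The noise alone contributes \<open>2 * s ^ 4 * (a i)\<^sup>2\<close> to the
    variance, whatever the signal.\<close>
  show "norm ((A i i)\<^sup>2) \<le> var (\<lambda>i. A i i) i / (2 * s ^ 4)" for i
    using s_pos by (simp add: var_centered_square field_simps)
qed

end

lemma integral_abs_le_sqrt:
  assumes "f \<in> L2"
  shows "(\<integral>z. \<bar>f z\<bar> \<partial>gauss_noise) \<le> sqrt (\<integral>z. (f z)\<^sup>2 \<partial>gauss_noise)"
proof -
  have "(\<lambda>z. \<bar>f z\<bar>) \<in> L2" by (rule L2_bound[OF assms]) (use assms in auto)
  from square_integral_le[OF this] show ?thesis by (simp add: real_le_rsqrt)
qed

section \<open>Convergence of the diagonal means and the risk of the diagonal part\<close>

context signal
begin

text \<open>Almost sure convergence of the form and mean-square convergence of its off-diagonal and centred diagonal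
  parts leave no freedom for the deterministic diagonal means; truncation at 1 makes dominated convergence applicable.\<close>

lemma controlled_diag_mean_convergent:
  assumes c: "controlled A k M"
  shows "convergent (diag_mean (\<lambda>i. A i i))"
proof -
  define a where "a i = A i i" for i
  have a2: "summable (\<lambda>i. (a i)\<^sup>2)" using controlled_diag_summable[OF c] by (simp add: a_def)
  \<comment> \<open>\<open>w N\<close> is the form without its centred diagonal part. It converges
    almost surely, because both the form and the removed part do.\<close>
  define w where "w N z = offdiag_part A N z + diag_mean a N" for N z
  define v where "v z = lim (\<lambda>N. w N z)" for z
  have [measurable]: "offdiag_part A N \<in> borel_measurable gauss_noise" for N using L2_offdiag_part by simp
  have [measurable]: "w N \<in> borel_measurable gauss_noise" for N unfolding w_def[abs_def] by measurable
  have [measurable]: "v \<in> borel_measurable gauss_noise" unfolding v_def[abs_def] by measurable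
  have w: "AE z in gauss_noise. (\<lambda>N. w N z) \<longlonglongrightarrow> v z"
    using controlled_convergent[OF c] centered_limit(1)[OF a2]
  proof eventually_elim
    case (elim z)
    have "(\<lambda>N. qpart A (Y z) N - (\<Sum>i<N. centered_square a i (z i))) \<longlonglongrightarrow> lim (qpart A (Y z)) - centered_limit a z"
      by (intro tendsto_diff) (use elim in \<open>simp_all add: convergent_LIMSEQ_iff\<close>)
    moreover have "(\<lambda>N. qpart A (Y z) N - (\<Sum>i<N. centered_square a i (z i))) = (\<lambda>N. w N z)"
      by (simp add: fun_eq_iff qpart_Y w_def a_def[abs_def])
    ultimately show ?case unfolding v_def by (simp add: limI)
  qed
  define h where "h N = (\<integral>z. min 1 \<bar>w N z - v z\<bar> \<partial>gauss_noise)" for N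
  have h: "h \<longlonglongrightarrow> 0"
  proof -
    have "h \<longlonglongrightarrow> (\<integral>z. 0 \<partial>gauss_noise)"
      unfolding h_def[abs_def]
    proof (rule integral_dominated_convergence[where w = "\<lambda>_. 1"])
      show "AE z in gauss_noise. (\<lambda>N. min 1 \<bar>w N z - v z\<bar>) \<longlonglongrightarrow> 0"
        using w
      proof eventually_elim
        case (elim z)
        have "(\<lambda>N. min 1 \<bar>w N z - v z\<bar>) \<longlonglongrightarrow> min 1 \<bar>v z - v z\<bar>"
          by (intro tendsto_min tendsto_rabs tendsto_diff tendsto_const elim)
        then show ?case by simp
      qed
    qed auto
    then show ?thesis by simp
  qed
  define C where "C = 4 * (Qf \<theta> + s\<^sup>2)\<^sup>2"
  \<comment> \<open>The difference of the means is \<open>w N - v\<close>, minus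
    \<open>w L - v\<close>, minus the off-diagonal increment. The truncated triangle inequality and
    Cauchy-Schwarz for the increment give the bound.\<close>
  have key: "min 1 \<bar>diag_mean a N - diag_mean a L\<bar> \<le> h N + h L + sqrt (C * (offdiag_norm A N - offdiag_norm A L))" if "L \<le> N" for N L
  proof -
    have o: "(\<lambda>z. offdiag_part A N z - offdiag_part A L z) \<in> L2" by (intro L2_diff L2_offdiag_part)
    have ih: "integrable gauss_noise (\<lambda>z. min 1 \<bar>w N z - v z\<bar>)" for N
      by (rule gauss.integrable_const_bound[where B = 1]) auto
    have io: "integrable gauss_noise (\<lambda>z. \<bar>offdiag_part A N z - offdiag_part A L z\<bar>)"
      using L2_integrable[OF o] by (rule integrable_abs)
    have "min 1 \<bar>diag_mean a N - diag_mean a L\<bar> = (\<integral>z. min 1 \<bar>diag_mean a N - diag_mean a L\<bar> \<partial>gauss_noise)" by simp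
    also have "\<dots> \<le> (\<integral>z. min 1 \<bar>w N z - v z\<bar> + min 1 \<bar>w L z - v z\<bar> + \<bar>offdiag_part A N z - offdiag_part A L z\<bar> \<partial>gauss_noise)"
      by (intro integral_mono Bochner_Integration.integrable_add ih io) (auto simp: w_def)
    also have "\<dots> = h N + h L + (\<integral>z. \<bar>offdiag_part A N z - offdiag_part A L z\<bar> \<partial>gauss_noise)"
      unfolding h_def using ih io by simp
    also have "(\<integral>z. \<bar>offdiag_part A N z - offdiag_part A L z\<bar> \<partial>gauss_noise) \<le> sqrt (C * (offdiag_norm A N - offdiag_norm A L))"
      using integral_abs_le_sqrt[OF o] offdiag_part_increment[OF that, of A] unfolding C_def
      by (meson order_trans real_sqrt_le_mono)
    finally show ?thesis by simp
  qed
  have "Cauchy (diag_mean a)"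
    unfolding Cauchy_altdef2
  proof (intro allI impI)
    fix e :: real assume "e > 0"
    \<comment> \<open>The three terms of \<open>key\<close> total less than \<open>4 * d\<close>,
      and \<open>4 * d\<close> is at most 1, so the truncation at 1 is inactive and the difference
      itself falls below \<open>e\<close>.\<close>
    define d where "d = min e 1 / 4"
    have d: "d > 0" "d \<le> 1 / 4" "4 * d \<le> e" using \<open>e > 0\<close> by (auto simp: d_def)
    define b where "b = d\<^sup>2 / (C + 1)"
    have C: "C \<ge> 0" by (simp add: C_def)
    then have b: "b > 0" using d by (simp add: b_def)
    obtain N1 where N1: "\<And>N. N \<ge> N1 \<Longrightarrow> \<bar>h N\<bar> < d"
      using LIMSEQ_D[OF h d(1)] by auto
    have "Cauchy (offdiag_norm A)" using controlled_offdiag_norm_convergent[OF c] by (rule convergent_Cauchy)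
    then obtain N2 where N2: "\<And>N. N \<ge> N2 \<Longrightarrow> \<bar>offdiag_norm A N - offdiag_norm A N2\<bar> < b / 2"
      unfolding Cauchy_altdef2 dist_real_def using b by (meson half_gt_zero)
    define L where "L = max N1 N2"
    have "dist (diag_mean a N) (diag_mean a L) < e" if N: "N \<ge> L" for N
    proof -
      have "offdiag_norm A N - offdiag_norm A L \<le> b" using N2[of N] N2[of L] N by (auto simp: L_def abs_less_iff simp del: less_divide_eq_numeral1)
      then have "C * (offdiag_norm A N - offdiag_norm A L) \<le> C * b" using C by (rule mult_left_mono)
      also have "\<dots> \<le> d\<^sup>2" using C d by (simp add: b_def field_simps)
      finally have "sqrt (C * (offdiag_norm A N - offdiag_norm A L)) \<le> d" using d by (simp add: real_le_lsqrt)
      moreover have "h N < d" "h L < d" using N1[of N] N1[of L] N by (auto simp: L_def)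
      ultimately have "min 1 \<bar>diag_mean a N - diag_mean a L\<bar> < 4 * d" using key[OF N] d by linarith
      then show ?thesis using d by (auto simp: dist_real_def min_def split: if_splits)
    qed
    then show "\<exists>N. \<forall>n\<ge>N. dist (diag_mean a n) (diag_mean a N) < e" by blast
  qed
  then show ?thesis by (simp add: Cauchy_convergent_iff a_def[abs_def])
qed

text \<open>In the convergent means the signal part converges by itself, so the noise part, which is
  \<open>s\<^sup>2\<close> times the partial trace, converges too. This convergence may be
  conditional.\<close>

lemma controlled_trace_summable:
  assumes c: "controlled A k M"
  shows "summable (\<lambda>i. A i i)"
proof -
  have "convergent (\<lambda>N. (diag_mean (\<lambda>i. A i i) N - (\<Sum>i<N. A i i * (\<theta> i)\<^sup>2)) / s\<^sup>2)"
    using controlled_diag_mean_convergent[OF c] summable_weighted_signal(1)[OF controlled_diag_summable[OF c]]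
    unfolding summable_iff_convergent divide_inverse by (intro convergent_mult convergent_diff convergent_const)
  also have "(\<lambda>N. (diag_mean (\<lambda>i. A i i) N - (\<Sum>i<N. A i i * (\<theta> i)\<^sup>2)) / s\<^sup>2) = (\<lambda>N. \<Sum>i<N. A i i)"
    using s_pos by (simp add: fun_eq_iff diag_mean_def sum_subtractf[symmetric] algebra_simps sum_distrib_right[symmetric] sum.distrib)
  finally show ?thesis by (simp add: summable_iff_convergent)
qed

text \<open>Variance plus squared bias of the diagonal estimator when \<open>k\<close> is
  \<open>c - Qf \<theta>\<close>.\<close>

definition diag_risk :: "(nat \<Rightarrow> real) \<Rightarrow> real \<Rightarrow> real" where
  "diag_risk a k = (\<Sum>i. (a i)\<^sup>2 * (2 * s ^ 4 + 4 * s\<^sup>2 * (\<theta> i)\<^sup>2)) + ((\<Sum>i. a i * ((\<theta> i)\<^sup>2 + s\<^sup>2)) + k)\<^sup>2"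

lemma
  assumes a: "summable (\<lambda>i. (a i)\<^sup>2)" "summable a"
  shows diag_mean_LIMSEQ: "diag_mean a \<longlonglongrightarrow> (\<Sum>i. a i * ((\<theta> i)\<^sup>2 + s\<^sup>2))"
    and diag_risk_eq: "(\<integral>z. (centered_limit a z + ((\<Sum>i. a i * ((\<theta> i)\<^sup>2 + s\<^sup>2)) + k))\<^sup>2 \<partial>gauss_noise) = diag_risk a k"
proof -
  have "summable (\<lambda>i. a i * ((\<theta> i)\<^sup>2 + s\<^sup>2))"
    using summable_weighted_signal(1)[OF a(1)] a(2) by (auto simp: distrib_left intro!: summable_add summable_mult2)
  from summable_LIMSEQ[OF this] show "diag_mean a \<longlonglongrightarrow> (\<Sum>i. a i * ((\<theta> i)\<^sup>2 + s\<^sup>2))"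
    by (simp add: diag_mean_def[abs_def])
  show "(\<integral>z. (centered_limit a z + ((\<Sum>i. a i * ((\<theta> i)\<^sup>2 + s\<^sup>2)) + k))\<^sup>2 \<partial>gauss_noise) = diag_risk a k"
    unfolding centered_limit(3)[OF a(1)] diag_risk_def var_centered_square ..
qed

text \<open>Each stripped form has second moment at most \<open>M\<close> and differs from the
  diagonal form by a remainder that vanishes in mean square as \<open>K\<close> grows. Since the two
  need not be orthogonal, the cross term is absorbed with a weight eta; \<open>K\<close> tends to
  infinity for fixed eta, and only then eta tends to 0.\<close>

theorem controlled_diag_risk_le:
  assumes c: "controlled A k M"
  shows "diag_risk (\<lambda>i. A i i) k \<le> M"
proof -
  define a where "a i = A i i" for i
  have a: "summable (\<lambda>i. (a i)\<^sup>2)" "summable a"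
    using controlled_diag_summable[OF c] controlled_trace_summable[OF c] by (simp_all add: a_def[abs_def])
  define m where "m = (\<Sum>i. a i * ((\<theta> i)\<^sup>2 + s\<^sup>2)) + k"
  define x where "x z = centered_limit a z + m" for z
  have x: "x \<in> L2" unfolding x_def[abs_def] by (intro L2_add centered_limit(2)[OF a(1)]) simp
  define C where "C = 4 * (Qf \<theta> + s\<^sup>2)\<^sup>2"
  have C: "C \<ge> 0" by (simp add: C_def)
  define b where "b = lim (offdiag_norm A)"
  have hs_lim: "offdiag_norm A \<longlonglongrightarrow> b"
    using controlled_offdiag_norm_convergent[OF c] by (simp add: b_def convergent_LIMSEQ_iff)
  have hs_le: "offdiag_norm A N \<le> b" for N
    using hs_lim by (rule LIMSEQ_le_const) (auto intro: offdiag_norm_mono)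
  have step: "(1 - \<eta>) * (\<integral>z. (x z)\<^sup>2 \<partial>gauss_noise) \<le> M + C * (b - offdiag_norm A K) / \<eta>" if \<eta>: "\<eta> > 0" for \<eta> K
  proof -
    note cs = controlled_strip[OF c, of K]
    define u where "u z = lim (qpart (strip K A) (Y z)) + k" for z
    have u: "u \<in> L2" and uM: "(\<integral>z. (u z)\<^sup>2 \<partial>gauss_noise) \<le> M"
      using controlled_L2[OF cs] controlled_le[OF cs] by (simp_all add: u_def[abs_def])
    define r where "r z = u z - x z" for z
    have lim: "AE z in gauss_noise. (\<lambda>N. offdiag_part (strip K A) N z) \<longlonglongrightarrow> r z"
      using controlled_convergent[OF cs] centered_limit(1)[OF a(1)]
    proof eventually_elim
      case (elim z)
      have "(\<lambda>N. qpart (strip K A) (Y z) N - (\<Sum>i<N. centered_square a i (z i)) - diag_mean a N)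
          \<longlonglongrightarrow> lim (qpart (strip K A) (Y z)) - centered_limit a z - (m - k)"
        unfolding m_def by (intro tendsto_diff) (use elim diag_mean_LIMSEQ[OF a] in \<open>simp_all add: convergent_LIMSEQ_iff\<close>)
      then show ?case by (simp add: qpart_Y a_def[abs_def] r_def u_def x_def algebra_simps)
    qed
    have r: "r \<in> L2" unfolding r_def[abs_def] by (intro L2_diff u x)
    have "(\<integral>z. (offdiag_part (strip K A) N z)\<^sup>2 \<partial>gauss_noise) \<le> C * (b - offdiag_norm A K)" for N
      using offdiag_part_strip_le[of K A N] hs_le[of "max K N"] C unfolding C_def[symmetric]
      by (meson diff_right_mono mult_left_mono order_trans)
    then have r2: "(\<integral>z. (r z)\<^sup>2 \<partial>gauss_noise) \<le> C * (b - offdiag_norm A K)"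
      by (rule integral_square_Fatou[OF L2_offdiag_part _ _ lim]) (use r in auto)
    have "- (2 * (\<integral>z. x z * r z \<partial>gauss_noise)) = (\<integral>z. - (2 * (x z * r z)) \<partial>gauss_noise)" by simp
    also have "\<dots> \<le> (\<integral>z. \<eta> * (x z)\<^sup>2 + (r z)\<^sup>2 / \<eta> \<partial>gauss_noise)"
    proof (rule integral_mono)
      fix z
      \<comment> \<open>Young's inequality: the small weight falls on the fixed \<open>x z\<close>,
        the large weight on the remainder \<open>r z\<close>, which is sent to 0.\<close>
      have "0 \<le> (\<eta> * x z + r z)\<^sup>2 / \<eta>" using \<eta> by simp
      also have "\<dots> = \<eta> * (x z)\<^sup>2 + 2 * (x z * r z) + (r z)\<^sup>2 / \<eta>"
        using \<eta> by (simp add: power2_eq_square field_simps)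
      finally show "- (2 * (x z * r z)) \<le> \<eta> * (x z)\<^sup>2 + (r z)\<^sup>2 / \<eta>" by simp
    qed (use x r L2_mult_integrable[OF x r] in \<open>auto simp: L2_integrable_square\<close>)
    also have "\<dots> = \<eta> * (\<integral>z. (x z)\<^sup>2 \<partial>gauss_noise) + (\<integral>z. (r z)\<^sup>2 \<partial>gauss_noise) / \<eta>"
      using x r by (simp add: L2_integrable_square)
    finally have "- (2 * (\<integral>z. x z * r z \<partial>gauss_noise))
        \<le> \<eta> * (\<integral>z. (x z)\<^sup>2 \<partial>gauss_noise) + (\<integral>z. (r z)\<^sup>2 \<partial>gauss_noise) / \<eta>" .
    moreover have "(\<integral>z. (r z)\<^sup>2 \<partial>gauss_noise) / \<eta> \<le> C * (b - offdiag_norm A K) / \<eta>"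
      using r2 \<eta> by (simp add: divide_right_mono)
    moreover have "(\<integral>z. (u z)\<^sup>2 \<partial>gauss_noise) = (\<integral>z. (x z)\<^sup>2 \<partial>gauss_noise) + 2 * (\<integral>z. x z * r z \<partial>gauss_noise) + (\<integral>z. (r z)\<^sup>2 \<partial>gauss_noise)"
      using integral_square_add[OF x r] by (simp add: r_def)
    moreover have "0 \<le> (\<integral>z. (r z)\<^sup>2 \<partial>gauss_noise)" by simp
    ultimately show ?thesis using uM unfolding left_diff_distrib by linarith
  qed
  have le: "(1 - \<eta>) * (\<integral>z. (x z)\<^sup>2 \<partial>gauss_noise) \<le> M" if \<eta>: "\<eta> > 0" for \<eta>
  proof (rule LIMSEQ_le_const)
    have "(\<lambda>K. M + C * (b - offdiag_norm A K) / \<eta>) \<longlonglongrightarrow> M + C * (b - b) / \<eta>"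
      by (intro tendsto_intros hs_lim) (use \<eta> in auto)
    then show "(\<lambda>K. M + C * (b - offdiag_norm A K) / \<eta>) \<longlonglongrightarrow> M" by simp
  qed (use step[OF \<eta>] in auto)
  have "(\<integral>z. (x z)\<^sup>2 \<partial>gauss_noise) \<le> M"
  proof (rule tendsto_upperbound)
    show "((\<lambda>\<eta>. (1 - \<eta>) * (\<integral>z. (x z)\<^sup>2 \<partial>gauss_noise)) \<longlongrightarrow> (\<integral>z. (x z)\<^sup>2 \<partial>gauss_noise)) (at_right 0)"
      by (auto intro!: tendsto_eq_intros)
    show "\<forall>\<^sub>F \<eta> in at_right 0. (1 - \<eta>) * (\<integral>z. (x z)\<^sup>2 \<partial>gauss_noise) \<le> M"
      using le by (auto intro: eventually_at_right_less[THEN eventually_mono])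
  qed simp
  then show ?thesis unfolding x_def m_def diag_risk_eq[OF a] by (simp add: a_def[abs_def])
qed

text \<open>The two summability conditions do not mention the signal. Obtained at one signal, they
  give convergence and the risk formula at every other one, in particular at points of the hull
  where no risk bound is known yet.\<close>

lemma diagonal_convergent:
  assumes a: "summable (\<lambda>i. (a i)\<^sup>2)" "summable a"
  defines "D \<equiv> \<lambda>i j. if i = j then a i else 0"
  shows "AE z in gauss_noise. convergent (qpart D (Y z))"
    and "(\<integral>\<^sup>+z. ennreal ((lim (qpart D (Y z)) + k)\<^sup>2) \<partial>gauss_noise) = ennreal (diag_risk a k)"
proof -
  let ?m = "\<Sum>i. a i * ((\<theta> i)\<^sup>2 + s\<^sup>2)"
  have D: "offdiag_part D N z = 0" "(\<lambda>i. D i i) = a" for N z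
    by (auto simp: offdiag_part_def offdiag_def D_def intro!: sum.neutral)
  have lim: "AE z in gauss_noise. qpart D (Y z) \<longlonglongrightarrow> centered_limit a z + ?m"
    using centered_limit(1)[OF a(1)]
  proof eventually_elim
    case (elim z)
    have "(\<lambda>N. (\<Sum>i<N. centered_square a i (z i)) + diag_mean a N) \<longlonglongrightarrow> centered_limit a z + ?m"
      by (intro tendsto_add elim diag_mean_LIMSEQ a)
    then show ?case by (simp add: qpart_Y[abs_def] D)
  qed
  then show "AE z in gauss_noise. convergent (qpart D (Y z))"
    by eventually_elim (auto simp: convergent_def)
  have "(\<integral>\<^sup>+z. ennreal ((lim (qpart D (Y z)) + k)\<^sup>2) \<partial>gauss_noise) = (\<integral>\<^sup>+z. ennreal ((centered_limit a z + (?m + k))\<^sup>2) \<partial>gauss_noise)"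
    by (rule nn_integral_cong_AE, use lim in eventually_elim) (simp add: limI add.assoc)
  also have "\<dots> = ennreal (diag_risk a k)"
    unfolding diag_risk_eq[OF a, symmetric] by (intro nn_integral_L2 L2_add centered_limit(2) a L2_const)
  finally show "(\<integral>\<^sup>+z. ennreal ((lim (qpart D (Y z)) + k)\<^sup>2) \<partial>gauss_noise) = ennreal (diag_risk a k)" .
qed

end

section \<open>Diagonal estimators and the quadratic hull\<close>

context signal
begin

lemma controlledI:
  assumes "\<And>e. signs e \<Longrightarrow> AE z in gauss_noise. convergent (qpart A (\<lambda>i. e i * Y z i))"
    and "\<And>e. signs e \<Longrightarrow>
      (\<integral>\<^sup>+z. ennreal ((lim (qpart A (\<lambda>i. e i * Y z i)) + k)\<^sup>2) \<partial>gauss_noise) \<le> ennreal M"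
    and "0 \<le> M"
  shows "controlled A k M"
  unfolding controlled_def using assms by (auto intro!: L2_nn_integralI integral_square_le)

end

abbreviation diag_matrix :: "(nat \<Rightarrow> real) \<Rightarrow> nat \<Rightarrow> nat \<Rightarrow> real" where
  "diag_matrix a \<equiv> \<lambda>i j. if i = j then a i else 0"

section \<open>From bounds on \<open>risk\<close> to controlled forms and back\<close>

lemma Yobs_eq_Y:
  assumes "signal \<theta> (1 / sqrt (real n))"
  shows "Yobs n \<theta> z = signal.Y \<theta> (1 / sqrt (real n)) z"
  by (simp add: fun_eq_iff Yobs_def signal.Y_def[OF assms])

lemma signalI: "summable (\<lambda>i. (\<theta> i)\<^sup>2) \<Longrightarrow> n > 0 \<Longrightarrow> signal \<theta> (1 / sqrt (real n))"
  by unfold_locales auto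

lemma sign_square: "signs e \<Longrightarrow> (e i * x)\<^sup>2 = x\<^sup>2"
  using signs_square[of e i] by (simp add: power_mult_distrib power2_eq_square)

lemma Yobs_signs: "signs e \<Longrightarrow> Yobs n (\<lambda>i. e i * \<theta> i) (\<lambda>i. e i * z i) = (\<lambda>i. e i * Yobs n \<theta> z i)"
  by (simp add: Yobs_def fun_eq_iff algebra_simps)

text \<open>A finite bound excludes the default value \<open>\<infinity>\<close> of
  \<open>risk\<close>, and therefore carries square summability of the signal and almost sure
  convergence with it.\<close>

lemma risk_le_iff:
  assumes "M < \<infinity>"
  shows "risk n A c \<theta> \<le> M \<longleftrightarrow> summable (\<lambda>i. (\<theta> i)\<^sup>2) \<and> (AE z in gauss_noise. convergent (qpart A (Yobs n \<theta> z))) \<and>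
     (\<integral>\<^sup>+ z. ennreal ((lim (qpart A (Yobs n \<theta> z)) + (c - Qf \<theta>))\<^sup>2) \<partial>gauss_noise) \<le> M"
  using assms by (auto simp: risk_def qest_def algebra_simps top_unique)

lemma risk_signs_controlled:
  assumes n: "n > 0" and r: "\<And>e. signs e \<Longrightarrow> risk n A c (\<lambda>i. e i * \<theta> i) \<le> ennreal M" and M: "0 \<le> M"
  shows "summable (\<lambda>i. (\<theta> i)\<^sup>2)"
    and "signal.controlled \<theta> (1 / sqrt (real n)) A (c - Qf \<theta>) M"
proof -
  note r' = r[unfolded risk_le_iff[OF ennreal_less_top[unfolded infinity_ennreal_def[symmetric]]]]
  have "signs (\<lambda>_. 1)" by (simp add: signs_def)
  from r'[OF this] show s: "summable (\<lambda>i. (\<theta> i)\<^sup>2)" by simp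
  interpret signal \<theta> "1 / sqrt (real n)" by (rule signalI[OF s n])
  show "controlled A (c - Qf \<theta>) M"
  proof (rule controlledI[OF _ _ M])
    fix e assume e: "signs e"
    have Q: "Qf (\<lambda>i. e i * \<theta> i) = Qf \<theta>" by (simp add: Qf_def sign_square[OF e])
    have Y': "Yobs n (\<lambda>i. e i * \<theta> i) (\<lambda>i. e i * z i) = (\<lambda>i. e i * Y z i)" for z
      unfolding Yobs_signs[OF e] Yobs_eq_Y[OF signal_axioms] ..
    show "AE z in gauss_noise. convergent (qpart A (\<lambda>i. e i * Y z i))"
      using AE_gauss_signs[OF e, of "\<lambda>z. convergent (qpart A (Yobs n (\<lambda>i. e i * \<theta> i) z))"] r'[OF e]
      unfolding Y' by blast
    have [measurable]: "(\<lambda>z. Yobs n (\<lambda>i. e i * \<theta> i) z i) \<in> borel_measurable gauss_noise" for i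
      unfolding Yobs_def by measurable
    have "(\<integral>\<^sup>+z. ennreal ((lim (qpart A (\<lambda>i. e i * Y z i)) + (c - Qf \<theta>))\<^sup>2) \<partial>gauss_noise)
      = (\<integral>\<^sup>+z. ennreal ((lim (qpart A (Yobs n (\<lambda>i. e i * \<theta> i) z)) + (c - Qf \<theta>))\<^sup>2) \<partial>gauss_noise)"
      unfolding Y'[symmetric] by (rule nn_integral_gauss_signs[OF e]) measurable
    then show "(\<integral>\<^sup>+z. ennreal ((lim (qpart A (\<lambda>i. e i * Y z i)) + (c - Qf \<theta>))\<^sup>2) \<partial>gauss_noise) \<le> ennreal M"
      using r'[OF e] unfolding Q by simp
  qed
qed

text \<open>A diagonal form does not see signs, so a bound at one signal is already a bound for all
  patterns. The facts about controlled forms thus also yield the summability of the coefficients of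
  a diagonal estimator.\<close>

lemma risk_diag_controlled:
  assumes n: "n > 0" and r: "risk n (diag_matrix a) c \<theta> \<le> ennreal M" and M: "0 \<le> M"
  shows "summable (\<lambda>i. (\<theta> i)\<^sup>2)"
    and "signal.controlled \<theta> (1 / sqrt (real n)) (diag_matrix a) (c - Qf \<theta>) M"
proof -
  note r' = r[unfolded risk_le_iff[OF ennreal_less_top[unfolded infinity_ennreal_def[symmetric]]]]
  from r' show s: "summable (\<lambda>i. (\<theta> i)\<^sup>2)" by simp
  interpret signal \<theta> "1 / sqrt (real n)" by (rule signalI[OF s n])
  have eq: "qpart (diag_matrix a) (\<lambda>i. e i * y i) = qpart (diag_matrix a) y" if "signs e" for e y
    unfolding qpart_def by (intro ext sum.cong refl) (use signs_square[OF that] in \<open>simp add: algebra_simps\<close>)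
  show "controlled (diag_matrix a) (c - Qf \<theta>) M"
    using r' by (intro controlledI M) (auto simp: eq Yobs_eq_Y[OF signal_axioms])
qed

lemma risk_diag_matrix:
  assumes n: "n > 0" and \<theta>: "summable (\<lambda>i. (\<theta> i)\<^sup>2)" and a: "summable (\<lambda>i. (a i)\<^sup>2)" "summable a"
  shows "risk n (diag_matrix a) c \<theta> = ennreal (signal.diag_risk \<theta> (1 / sqrt (real n)) a (c - Qf \<theta>))"
proof -
  interpret signal \<theta> "1 / sqrt (real n)" by (rule signalI[OF \<theta> n])
  show ?thesis
    using \<theta> diagonal_convergent(1)[OF a] diagonal_convergent(2)[OF a, of "c - Qf \<theta>"]
    by (simp add: risk_def qest_def Yobs_eq_Y[OF signal_axioms] add_diff_eq)
qed

section \<open>Convexity of the diagonal risk over the quadratic hull\<close>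

lemma convex_square:
  fixes w b :: "nat \<Rightarrow> real"
  assumes "\<And>j. j < k \<Longrightarrow> 0 \<le> w j" "(\<Sum>j<k. w j) = 1"
  shows "(\<Sum>j<k. w j * b j)\<^sup>2 \<le> (\<Sum>j<k. w j * (b j)\<^sup>2)"
proof -
  define B where "B = (\<Sum>j<k. w j * b j)"
  \<comment> \<open>The variance of the values \<open>b j\<close> under the weights \<open>w\<close>
    is nonnegative; expanding it gives the claim.\<close>
  have "0 \<le> (\<Sum>j<k. w j * (b j - B)\<^sup>2)" using assms by (intro sum_nonneg) auto
  also have "\<dots> = (\<Sum>j<k. w j * (b j)\<^sup>2 - 2 * B * (w j * b j) + B\<^sup>2 * w j)"
    by (intro sum.cong) (auto simp: power2_eq_square algebra_simps)
  also have "\<dots> = (\<Sum>j<k. w j * (b j)\<^sup>2) - 2 * B * B + B\<^sup>2"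
    unfolding sum.distrib sum_subtractf sum_distrib_left[symmetric] assms(2) by (simp add: B_def)
  finally show ?thesis by (simp add: B_def power2_eq_square)
qed

text \<open>Only nonnegative members contribute to \<open>sq_pos\<close>; orthosymmetry supplies the
  one obtained by taking absolute values, which has the same squares.\<close>

lemma subset_QHull:
  assumes "orthosymmetric \<Theta>"
  shows "\<Theta> \<subseteq> QHull \<Theta>"
proof
  fix \<theta> assume \<theta>: "\<theta> \<in> \<Theta>"
  define e :: seq where "e i = (if \<theta> i < 0 then -1 else 1)" for i
  have "(\<lambda>i. e i * \<theta> i) \<in> \<Theta>"
    using assms \<theta> by (auto simp: orthosymmetric_def e_def)
  then have "(\<lambda>i. (e i * \<theta> i)\<^sup>2) \<in> sq_pos \<Theta>"
    unfolding sq_pos_def by (intro CollectI exI[of _ "\<lambda>i. e i * \<theta> i"]) (auto simp: e_def)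
  also have "(\<lambda>i. (e i * \<theta> i)\<^sup>2) = (\<lambda>i. (\<theta> i)\<^sup>2)" by (simp add: fun_eq_iff e_def)
  finally show "\<theta> \<in> QHull \<Theta>"
    unfolding QHull_def seq_hull_def
    by (intro CollectI exI[of _ "1::nat"] exI[of _ "\<lambda>_. 1::real"] exI[of _ "\<lambda>_ i. (\<theta> i)\<^sup>2"]) auto
qed

lemma risk_diag_QHull_le:
  assumes n: "n > 0" and \<theta>: "\<theta> \<in> QHull \<Theta>" and M: "0 \<le> M"
    and r: "\<And>\<theta>. \<theta> \<in> \<Theta> \<Longrightarrow> risk n (diag_matrix a) c \<theta> \<le> ennreal M"
  shows "risk n (diag_matrix a) c \<theta> \<le> ennreal M"
proof -
  define s where "s = 1 / sqrt (real n)"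
  obtain k w p where wp: "\<And>j. j < (k::nat) \<Longrightarrow> 0 \<le> w j \<and> p j \<in> sq_pos \<Theta>" "(\<Sum>j<k. w j) = 1"
    and sq: "(\<lambda>i. (\<theta> i)\<^sup>2) = (\<lambda>i. \<Sum>j<k. w j * p j i)"
    using \<theta> unfolding QHull_def seq_hull_def by blast
  have "\<exists>q. q \<in> \<Theta> \<and> p j = (\<lambda>i. (q i)\<^sup>2)" if "j < k" for j
    using wp(1)[OF that] unfolding sq_pos_def by blast
  then obtain q where q: "\<And>j. j < k \<Longrightarrow> q j \<in> \<Theta>" "\<And>j. j < k \<Longrightarrow> p j = (\<lambda>i. (q j i)\<^sup>2)"
    by metis
  have \<theta>2: "(\<theta> i)\<^sup>2 = (\<Sum>j<k. w j * (q j i)\<^sup>2)" for i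
    using fun_cong[OF sq, of i] q(2) by (simp cong: sum.cong_simp)
  note rq = risk_diag_controlled[OF n r[OF q(1)] M]
  \<comment> \<open>Weights summing to 1 exclude an empty combination, so the signal
    \<open>q 0\<close> exists, and the summability of \<open>a\<close> is read off there.\<close>
  have "k > 0" using wp(2) by (cases k) auto
  have sg: "signal (q j) s" if "j < k" for j
    unfolding s_def by (rule signalI[OF rq(1)[OF that] n])
  have a: "summable (\<lambda>i. (a i)\<^sup>2)" "summable a"
    using signal.controlled_diag_summable[OF sg[OF \<open>k > 0\<close>] rq(2)[OF \<open>k > 0\<close>, folded s_def]]
      signal.controlled_trace_summable[OF sg[OF \<open>k > 0\<close>] rq(2)[OF \<open>k > 0\<close>, folded s_def]] by auto
  have mix: "(\<lambda>i. \<Sum>j<k. w j * f j i) sums (\<Sum>j<k. w j * (\<Sum>i. f j i))"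
    if "\<And>j. j < k \<Longrightarrow> summable (f j)" for f :: "nat \<Rightarrow> nat \<Rightarrow> real"
    using that by (intro sums_sum sums_mult summable_sums) auto
  have Q: "(\<lambda>i. (\<theta> i)\<^sup>2) sums (\<Sum>j<k. w j * Qf (q j))"
    unfolding \<theta>2 Qf_def by (rule mix[OF rq(1)])
  then have \<theta>s: "summable (\<lambda>i. (\<theta> i)\<^sup>2)" by (rule sums_summable)
  have s\<theta>: "signal \<theta> s" unfolding s_def by (rule signalI[OF \<theta>s n])
  define v where "v j i = (a i)\<^sup>2 * (2 * s ^ 4 + 4 * s\<^sup>2 * (q j i)\<^sup>2)" for j i
  define b where "b j i = a i * ((q j i)\<^sup>2 + s\<^sup>2)" for j i
  have vs: "summable (v j)" if "j < k" for j
    using signal.summable_var[OF sg[OF that] a(1)] unfolding signal.var_centered_square[OF sg[OF that], abs_def] v_def[abs_def] by simp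
  have bs: "summable (b j)" if "j < k" for j
    using signal.summable_weighted_signal(1)[OF sg[OF that] a(1)] a(2)
    by (auto simp: b_def[abs_def] distrib_left intro!: summable_add summable_mult2)
  \<comment> \<open>Weights summing to 1 reproduce the constant \<open>x\<close>, so affine
    functions of the squared signal commute with the mixture.\<close>
  have affine: "x + y * (\<theta> i)\<^sup>2 = (\<Sum>j<k. w j * (x + y * (q j i)\<^sup>2))" for x y i
  proof -
    have "(\<Sum>j<k. w j * (x + y * (q j i)\<^sup>2)) = x * (\<Sum>j<k. w j) + y * (\<Sum>j<k. w j * (q j i)\<^sup>2)"
      unfolding sum_distrib_left sum.distrib[symmetric] by (intro sum.cong) (auto simp: algebra_simps)
    then show ?thesis by (simp add: wp(2) \<theta>2)
  qed
  have "(\<lambda>i. (a i)\<^sup>2 * (2 * s ^ 4 + 4 * s\<^sup>2 * (\<theta> i)\<^sup>2)) = (\<lambda>i. \<Sum>j<k. w j * v j i)"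
    using affine[of "(a i)\<^sup>2 * (2 * s ^ 4)" "(a i)\<^sup>2 * (4 * s\<^sup>2)" i for i]
    by (simp add: fun_eq_iff v_def distrib_left[of "(a _)\<^sup>2"] mult.assoc)
  then have v: "(\<Sum>i. (a i)\<^sup>2 * (2 * s ^ 4 + 4 * s\<^sup>2 * (\<theta> i)\<^sup>2)) = (\<Sum>j<k. w j * (\<Sum>i. v j i))"
    using sums_unique[OF mix[of v, OF vs]] by simp
  have "(\<lambda>i. a i * ((\<theta> i)\<^sup>2 + s\<^sup>2)) = (\<lambda>i. \<Sum>j<k. w j * b j i)"
    using affine[of "a i * s\<^sup>2" "a i" i for i]
    by (simp add: fun_eq_iff b_def distrib_left[of "a _"] add.commute)
  then have b: "(\<Sum>i. a i * ((\<theta> i)\<^sup>2 + s\<^sup>2)) = (\<Sum>j<k. w j * (\<Sum>i. b j i))"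
    using sums_unique[OF mix[of b, OF bs]] by simp
  define d where "d j = (\<Sum>i. b j i) + (c - Qf (q j))" for j
  have d: "(\<Sum>j<k. w j * (\<Sum>i. b j i)) + (c - Qf \<theta>) = (\<Sum>j<k. w j * d j)"
  proof -
    have "(\<Sum>j<k. w j * d j) = (\<Sum>j<k. w j * (\<Sum>i. b j i)) + c * (\<Sum>j<k. w j) - (\<Sum>j<k. w j * Qf (q j))"
      unfolding d_def sum_distrib_left sum.distrib[symmetric] sum_subtractf[symmetric]
      by (intro sum.cong) (auto simp: algebra_simps)
    then show ?thesis using sums_unique[OF Q] by (simp add: wp(2) Qf_def)
  qed
  have form: "signal.diag_risk (q j) s a (c - Qf (q j)) = (\<Sum>i. v j i) + (d j)\<^sup>2" if "j < k" for j
    unfolding signal.diag_risk_def[OF sg[OF that]] d_def v_def b_def ..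
  have "signal.diag_risk \<theta> s a (c - Qf \<theta>) = (\<Sum>j<k. w j * (\<Sum>i. v j i)) + (\<Sum>j<k. w j * d j)\<^sup>2"
    unfolding signal.diag_risk_def[OF s\<theta>] v b d ..
  \<comment> \<open>The variance mixes with equality; the only inequality comes from the square of
    the bias.\<close>
  also have "\<dots> \<le> (\<Sum>j<k. w j * (\<Sum>i. v j i)) + (\<Sum>j<k. w j * (d j)\<^sup>2)"
    using convex_square[of k w d] wp by auto
  also have "\<dots> = (\<Sum>j<k. w j * signal.diag_risk (q j) s a (c - Qf (q j)))"
    unfolding sum.distrib[symmetric]
    by (intro sum.cong) (auto simp: form distrib_left)
  also have "\<dots> \<le> (\<Sum>j<k. w j * M)"
  proof (intro sum_mono mult_left_mono)
    fix j assume "j \<in> {..<k}"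
    then show "signal.diag_risk (q j) s a (c - Qf (q j)) \<le> M" "0 \<le> w j"
      using signal.controlled_diag_risk_le[OF sg rq(2)[folded s_def]] wp(1) by auto
  qed
  also have "\<dots> = M" using wp(2) by (simp add: sum_distrib_right[symmetric])
  finally show ?thesis
    unfolding risk_diag_matrix[OF n \<theta>s a] s_def[symmetric] by (rule ennreal_leI)
qed

lemma worst_risk_mono: "S \<subseteq> T \<Longrightarrow> worst_risk n A c S \<le> worst_risk n A c T"
  unfolding worst_risk_def by (rule SUP_subset_mono) auto

lemma worst_risk_QHull:
  assumes "orthosymmetric \<Theta>" "n > 0"
  shows "worst_risk n (diag_matrix a) c \<Theta> = worst_risk n (diag_matrix a) c (QHull \<Theta>)"
proof (rule antisym)
  show "worst_risk n (diag_matrix a) c \<Theta> \<le> worst_risk n (diag_matrix a) c (QHull \<Theta>)"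
    by (rule worst_risk_mono[OF subset_QHull[OF assms(1)]])
  show "worst_risk n (diag_matrix a) c (QHull \<Theta>) \<le> worst_risk n (diag_matrix a) c \<Theta>"
  proof (cases "worst_risk n (diag_matrix a) c \<Theta>")
    case (real M)
    then have le: "risk n (diag_matrix a) c \<theta> \<le> ennreal M" if "\<theta> \<in> \<Theta>" for \<theta>
      using SUP_upper[OF that, of "risk n (diag_matrix a) c"] by (simp add: worst_risk_def)
    show ?thesis
      unfolding real(2) worst_risk_def[of _ _ _ "QHull \<Theta>"]
      by (rule SUP_least, rule risk_diag_QHull_le[OF assms(2) _ real(1) le])
  qed simp
qed

text \<open>Orthosymmetry keeps all sign changes of a signal inside the parameter set, so the worst
  risk bounds the risk at each of them, as \<open>controlled\<close> demands. The constant
  \<open>c\<close> is left unchanged.\<close>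

lemma worst_risk_diag_le:
  assumes \<Theta>: "orthosymmetric \<Theta>" and n: "n > 0"
  shows "worst_risk n (diag_matrix (\<lambda>i. A i i)) c \<Theta> \<le> worst_risk n A c \<Theta>"
proof (cases "worst_risk n A c \<Theta>")
  case (real M)
  have le: "risk n A c \<theta> \<le> ennreal M" if "\<theta> \<in> \<Theta>" for \<theta>
    using SUP_upper[OF that, of "risk n A c"] real(2) by (simp add: worst_risk_def)
  show ?thesis
    unfolding real(2) worst_risk_def[of _ "diag_matrix _"]
  proof (rule SUP_least)
    fix \<theta> assume "\<theta> \<in> \<Theta>"
    then have "risk n A c (\<lambda>i. e i * \<theta> i) \<le> ennreal M" if "signs e" for e
      using that \<Theta> by (intro le) (auto simp: signs_def orthosymmetric_def)
    note c = risk_signs_controlled[OF n this real(1)]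
    interpret signal \<theta> "1 / sqrt (real n)" by (rule signalI[OF c(1) n])
    have "risk n (diag_matrix (\<lambda>i. A i i)) c \<theta> = ennreal (diag_risk (\<lambda>i. A i i) (c - Qf \<theta>))"
      by (rule risk_diag_matrix[OF n c(1) controlled_diag_summable[OF c(2)] controlled_trace_summable[OF c(2)]])
    then show "risk n (diag_matrix (\<lambda>i. A i i)) c \<theta> \<le> ennreal M"
      using ennreal_leI[OF controlled_diag_risk_le[OF c(2)]] by simp
  qed
qed simp

theorem theorem1:
  fixes \<Theta> :: "seq set" and n :: nat and a :: "nat \<Rightarrow> real" and c :: real
  assumes "orthosymmetric \<Theta>" and "n > 0"
  shows "worst_risk n (\<lambda>i j. if i = j then a i else 0) c \<Theta>
           = worst_risk n (\<lambda>i j. if i = j then a i else 0) c (QHull \<Theta>)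
         \<and> R_Q n \<Theta> = R_Q n (QHull \<Theta>) \<and> R_Q n (QHull \<Theta>) = R_DQ n (QHull \<Theta>)"
proof -
  \<comment> \<open>The three inequalities form a cycle, which forces equality throughout. The first
    two are monotonicity; the third takes the diagonal part of an arbitrary estimator and enlarges
    the parameter set to the hull at no cost.\<close>
  have 1: "R_Q n \<Theta> \<le> R_Q n (QHull \<Theta>)"
    unfolding R_Q_def by (intro INF_mono' worst_risk_mono subset_QHull assms)
  have 2: "R_Q n (QHull \<Theta>) \<le> R_DQ n (QHull \<Theta>)"
    unfolding R_Q_def R_DQ_def by (rule INF_superset_mono) auto
  have 3: "R_DQ n (QHull \<Theta>) \<le> R_Q n \<Theta>"
    unfolding R_Q_def
  proof (rule INF_greatest)
    fix Ac :: "(nat \<Rightarrow> nat \<Rightarrow> real) \<times> real"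
    let ?D = "diag_matrix (\<lambda>i. fst Ac i i)"
    have "R_DQ n (QHull \<Theta>) \<le> worst_risk n (fst (?D, snd Ac)) (snd (?D, snd Ac)) (QHull \<Theta>)"
      unfolding R_DQ_def by (rule INF_lower) (simp add: diagonal_def)
    also have "\<dots> = worst_risk n ?D (snd Ac) \<Theta>"
      using worst_risk_QHull[OF assms] by simp
    also have "\<dots> \<le> worst_risk n (fst Ac) (snd Ac) \<Theta>" by (rule worst_risk_diag_le[OF assms])
    finally show "R_DQ n (QHull \<Theta>) \<le> worst_risk n (fst Ac) (snd Ac) \<Theta>" .
  qed
  show ?thesis using worst_risk_QHull[OF assms] 1 2 3 by auto
qed

end
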